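(* Let $\dot q=g_0+ug_1$, $u\in\mathbb R$, be a control-affine system on a $5$-dimensional manifold $M$ satisfying $$\dim{\rm span}\bigl(g_0,g_1,[g_1,g_0],[g_1,[g_1,g_0]],[g_0,[g_1,g_0]]\bigr)=5 .$$ Then a five-dimensional control-affine system with two-dimensional input has the system $\dot q=g_0+ug_1$ as its reduction if and only if it is feedback equivalent to a system $$\dot q=g_0+u_1g_1+u_2(\alpha g_0+[g_0,g_1]),\qquad u_1,u_2\in\mathbb R,$$ where $\alpha$ is some function.
   Context: All objects are $C^\infty$. Control-affine systems $\dot q=f_0+u_1f_1+u_2f_2$ with two-dimensional input are assumed to have $f_0,f_1,f_2$ linearly independent. Two such systems on $M$ are feedback equivalent if one is obtained from the other by $u=\mathcal B(q)\tilde u+\mathcal A(q)$ with $\mathcal B(q)$ an invertible $2\times2$ matrix and $\mathcal A(q)\in\mathbb R^2$, i.e. if they have the same sets of admissible velocities at every point. Reduction. For $\dot q=f_0+u_1f_1+u_2f_2$ on a $5$-dimensional $M$ let $V(q)=\{f_0(q)+u_1f_1(q)+u_2f_2(q)\}$, $D_2={\rm span}(f_1,f_2)$, $D_3={\rm span}(f_0,f_1,f_2)$, $D^2=D+[D,D]$ for a distribution $D$. On $T^*M$ put $h_i(p,q)=p\cdot f_i(q)$, $\{h_i,h_j\}(p,q)=p\cdot[f_i,f_j](q)$; $\vec h$ is the Hamiltonian vector field of $h$, $\pi:T^*M\to M$ the projection, $\perp$ the annihilator in $T^*M$. On $(D_2)^\perp\setminus(D_2^2)^\perp$ let $\vec X=\vec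 h_0+\frac{\{h_0,h_2\}}{\{h_2,h_1\}}\vec h_1+\frac{\{h_1,h_0\}}{\{h_2,h_1\}}\vec h_2$ and ${\rm Abn}(q)=\{\pi_*\vec X(\lambda):\lambda\in T_q^*M\cap(D_3)^\perp\setminus(D_2^2)^\perp\}\subset V(q)$. If $\dim(D_2^2+D_3)=4$ and $\dim D_3^2=5$ (at all points), then ${\rm Abn}(q)$ is an affine line, and the control-affine system with scalar input whose set of admissible velocities at $q$ is ${\rm Abn}(q)$ is called the reduction of the system. *)

theory Defs
  imports "HOL-Analysis.Analysis"
begin

section \<open>Smooth manifolds\<close>

text \<open>
  All derivatives below are taken on open subsets of Euclidean spaces, where
  \<^const>\<open>frechet_derivative\<close> is the unique derivative of a differentiable map.
\<close>

primrec Ck_on :: "nat \<Rightarrow> 'e::euclidean_space set \<Rightarrow> ('e \<Rightarrow> 'f::real_normed_vector) \<Rightarrow> bool" where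
  "Ck_on 0 S f \<longleftrightarrow> continuous_on S f"
| "Ck_on (Suc k) S f \<longleftrightarrow> (\<forall>x\<in>S. f differentiable (at x)) \<and>
     (\<forall>v. Ck_on k S (\<lambda>x. frechet_derivative f (at x) v))"

definition smooth_on :: "'e::euclidean_space set \<Rightarrow> ('e \<Rightarrow> 'f::real_normed_vector) \<Rightarrow> bool" where
  "smooth_on S f \<longleftrightarrow> (\<forall>k. Ck_on k S f)"

text \<open>
  A manifold is a Hausdorff second-countable space (a type \<open>'a\<close> of these two classes) with an
  atlas of smoothly compatible charts onto open subsets of a Euclidean space \<open>'e\<close>. The atlas need
  not be maximal.
\<close>

type_synonym ('a, 'e) chart = "'a set \<times> ('a \<Rightarrow> 'e)"

abbreviation chart_dom :: "('a, 'e) chart \<Rightarrow> 'a set" where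
  "chart_dom \<equiv> fst"

abbreviation coords :: "('a, 'e) chart \<Rightarrow> 'a \<Rightarrow> 'e" where
  "coords \<equiv> snd"

definition chart_image :: "('a, 'e) chart \<Rightarrow> 'e set" where
  "chart_image c = coords c ` chart_dom c"

definition param :: "('a, 'e) chart \<Rightarrow> 'e \<Rightarrow> 'a" where
  "param c = inv_into (chart_dom c) (coords c)"

definition is_chart :: "('a::topological_space, 'e::euclidean_space) chart \<Rightarrow> bool" where
  "is_chart c \<longleftrightarrow> open (chart_dom c) \<and> open (chart_image c) \<and>
     homeomorphism (chart_dom c) (chart_image c) (coords c) (param c)"

definition smooth_atlas ::
  "('a::{t2_space,second_countable_topology}, 'e::euclidean_space) chart set \<Rightarrow> bool" where
  "smooth_atlas A \<longleftrightarrow> (\<forall>c\<in>A. is_chart c) \<and> (\<Union>c\<in>A. chart_dom c) = UNIV \<and>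
     (\<forall>c\<in>A. \<forall>d\<in>A. smooth_on (coords c ` (chart_dom c \<inter> chart_dom d)) (coords d \<circ> param c))"

definition smooth_map ::
  "('a, 'e::euclidean_space) chart set \<Rightarrow> ('a \<Rightarrow> 'f::real_normed_vector) \<Rightarrow> bool" where
  "smooth_map A F \<longleftrightarrow> (\<forall>c\<in>A. smooth_on (chart_image c) (F \<circ> param c))"


section \<open>Vector fields\<close>

text \<open>
  We fix a chart of the atlas around each point \<open>q\<close> and represent a tangent vector at \<open>q\<close> by its
  components in that chart, so that every tangent space is the vector space \<open>'e\<close>. A covector at
  \<open>q\<close> is likewise represented by its components \<open>p\<close> in the dual coordinates, and is paired with
  tangent vectors by the inner product of \<open>'e\<close>. \<open>transition_deriv A c q\<close> maps the
  components of a tangent vector at \<open>q\<close> in the fixed chart to its components in the chart \<open>c\<close>.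
\<close>

definition chart_at :: "('a, 'e) chart set \<Rightarrow> 'a \<Rightarrow> ('a, 'e) chart" where
  "chart_at A q = (SOME c. c \<in> A \<and> q \<in> chart_dom c)"

definition transition_deriv ::
  "('a, 'e::euclidean_space) chart set \<Rightarrow> ('a, 'e) chart \<Rightarrow> 'a \<Rightarrow> 'e \<Rightarrow> 'e" where
  "transition_deriv A c q =
     frechet_derivative (coords c \<circ> param (chart_at A q)) (at (coords (chart_at A q) q))"

definition vf_in_chart ::
  "('a, 'e::euclidean_space) chart set \<Rightarrow> ('a, 'e) chart \<Rightarrow> ('a \<Rightarrow> 'e) \<Rightarrow> 'e \<Rightarrow> 'e" where
  "vf_in_chart A c X x = transition_deriv A c (param c x) (X (param c x))"

definition vector_field :: "('a, 'e::euclidean_space) chart set \<Rightarrow> ('a \<Rightarrow> 'e) \<Rightarrow> bool" where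
  "vector_field A X \<longleftrightarrow> (\<forall>c\<in>A. smooth_on (chart_image c) (vf_in_chart A c X))"

definition lie_bracket ::
  "('a, 'e::euclidean_space) chart set \<Rightarrow> ('a \<Rightarrow> 'e) \<Rightarrow> ('a \<Rightarrow> 'e) \<Rightarrow> 'a \<Rightarrow> 'e" where
  "lie_bracket A X Y q =
     (let c = chart_at A q; x = coords c q; X' = vf_in_chart A c X; Y' = vf_in_chart A c Y
      in frechet_derivative Y' (at x) (X' x) - frechet_derivative X' (at x) (Y' x))"


section \<open>Distributions\<close>

definition set_plus_pt :: "('a \<Rightarrow> 'e::real_vector set) \<Rightarrow> ('a \<Rightarrow> 'e set) \<Rightarrow> 'a \<Rightarrow> 'e set" where
  "set_plus_pt D E q = {v + w |v w. v \<in> D q \<and> w \<in> E q}"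

definition is_section ::
  "('a, 'e::euclidean_space) chart set \<Rightarrow> ('a \<Rightarrow> 'e set) \<Rightarrow> ('a \<Rightarrow> 'e) \<Rightarrow> bool" where
  "is_section A D X \<longleftrightarrow> vector_field A X \<and> (\<forall>q. X q \<in> D q)"

definition bracket_dist ::
  "('a, 'e::euclidean_space) chart set \<Rightarrow> ('a \<Rightarrow> 'e set) \<Rightarrow> 'a \<Rightarrow> 'e set" where
  "bracket_dist A D q = span {lie_bracket A X Y q |X Y. is_section A D X \<and> is_section A D Y}"

definition dist_square ::
  "('a, 'e::euclidean_space) chart set \<Rightarrow> ('a \<Rightarrow> 'e set) \<Rightarrow> 'a \<Rightarrow> 'e set" where
  "dist_square A D = set_plus_pt D (bracket_dist A D)"


section \<open>The cotangent bundle\<close>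

text \<open>
  A point of the cotangent bundle is a pair \<open>(q, p)\<close> with \<open>p\<close> a covector at \<open>q\<close>. If \<open>\<xi>\<close> are the
  components of a covector at \<open>q\<close> in the chart \<open>c\<close>, then its components in the fixed chart at
  \<open>q\<close> are obtained by applying the transpose of \<open>transition_deriv A c q\<close>; thus
  \<open>cot_in_chart A c H\<close> is \<open>H\<close> in the canonical coordinates \<open>(x, \<xi>)\<close> induced by \<open>c\<close>.
\<close>

definition cot_in_chart ::
  "('a, 'e::euclidean_space) chart set \<Rightarrow> ('a, 'e) chart \<Rightarrow> ('a \<times> 'e \<Rightarrow> real) \<Rightarrow> 'e \<times> 'e \<Rightarrow> real" where
  "cot_in_chart A c H = (\<lambda>(x, \<xi>). H (param c x, adjoint (transition_deriv A c (param c x)) \<xi>))"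

text \<open>
  The Hamiltonian vector field at \<open>(q, p)\<close>, in the canonical coordinates induced by the fixed chart
  at \<open>q\<close>: its components are \<open>\<partial>H/\<partial>\<xi>\<close> and \<open>-\<partial>H/\<partial>x\<close>. In these coordinates the differential of
  the bundle projection is \<^const>\<open>fst\<close>.
\<close>

definition ham_vf ::
  "('a, 'e::euclidean_space) chart set \<Rightarrow> ('a \<times> 'e \<Rightarrow> real) \<Rightarrow> 'a \<times> 'e \<Rightarrow> 'e \<times> 'e" where
  "ham_vf A H = (\<lambda>(q, p).
     let c = chart_at A q;
         dH = frechet_derivative (cot_in_chart A c H) (at (coords c q, p))
     in (\<Sum>b\<in>Basis. dH (0, b) *\<^sub>R b, - (\<Sum>b\<in>Basis. dH (b, 0) *\<^sub>R b)))"

definition proj_deriv :: "'e \<times> 'e \<Rightarrow> 'e" where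
  "proj_deriv = fst"

definition ham :: "('a \<Rightarrow> 'e::euclidean_space) \<Rightarrow> 'a \<times> 'e \<Rightarrow> real" where
  "ham f = (\<lambda>(q, p). p \<bullet> f q)"

definition ham_bracket ::
  "('a, 'e::euclidean_space) chart set \<Rightarrow> ('a \<Rightarrow> 'e) \<Rightarrow> ('a \<Rightarrow> 'e) \<Rightarrow> 'a \<times> 'e \<Rightarrow> real" where
  "ham_bracket A f g = (\<lambda>(q, p). p \<bullet> lie_bracket A f g q)"

definition annihilator :: "('a \<Rightarrow> 'e::euclidean_space set) \<Rightarrow> ('a \<times> 'e) set" where
  "annihilator D = {(q, p). \<forall>v\<in>D q. p \<bullet> v = 0}"


section \<open>Control-affine systems with two-dimensional input\<close>

text \<open>
  Independence is stated for the list, so that coinciding vectors are excluded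
  (they would be identified in the set \<open>{f0 q, f1 q, f2 q}\<close>).
\<close>

definition control_system2 ::
  "('a, 'e::euclidean_space) chart set \<Rightarrow> ('a \<Rightarrow> 'e) \<Rightarrow> ('a \<Rightarrow> 'e) \<Rightarrow> ('a \<Rightarrow> 'e) \<Rightarrow> bool" where
  "control_system2 A f0 f1 f2 \<longleftrightarrow>
     vector_field A f0 \<and> vector_field A f1 \<and> vector_field A f2 \<and>
     (\<forall>q. distinct [f0 q, f1 q, f2 q] \<and> independent (set [f0 q, f1 q, f2 q]))"

definition feedback_equivalent ::
  "('a, 'e::euclidean_space) chart set \<Rightarrow> ('a \<Rightarrow> 'e) \<Rightarrow> ('a \<Rightarrow> 'e) \<Rightarrow> ('a \<Rightarrow> 'e) \<Rightarrow>
     ('a \<Rightarrow> 'e) \<Rightarrow> ('a \<Rightarrow> 'e) \<Rightarrow> ('a \<Rightarrow> 'e) \<Rightarrow> bool" where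
  "feedback_equivalent A f0 f1 f2 f0' f1' f2' \<longleftrightarrow>
     (\<exists>(\<B> :: 'a \<Rightarrow> real^2^2) (\<A> :: 'a \<Rightarrow> real^2).
        smooth_map A \<B> \<and> smooth_map A \<A> \<and> (\<forall>q. invertible (\<B> q)) \<and>
        (\<forall>q. \<forall>v :: real^2.
           let u = \<B> q *v v + \<A> q
           in f0 q + u$1 *\<^sub>R f1 q + u$2 *\<^sub>R f2 q = f0' q + v$1 *\<^sub>R f1' q + v$2 *\<^sub>R f2' q))"

definition D2 :: "('a \<Rightarrow> 'e::real_vector) \<Rightarrow> ('a \<Rightarrow> 'e) \<Rightarrow> 'a \<Rightarrow> 'e set" where
  "D2 f1 f2 q = span {f1 q, f2 q}"

definition D3 :: "('a \<Rightarrow> 'e::real_vector) \<Rightarrow> ('a \<Rightarrow> 'e) \<Rightarrow> ('a \<Rightarrow> 'e) \<Rightarrow> 'a \<Rightarrow> 'e set" where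
  "D3 f0 f1 f2 q = span {f0 q, f1 q, f2 q}"

text \<open>
  The next field is meaningful on the annihilator of \<open>D2\<close> minus that of its square,
  where the denominator does not vanish.
\<close>

definition abn_field ::
  "('a, 'e::euclidean_space) chart set \<Rightarrow> ('a \<Rightarrow> 'e) \<Rightarrow> ('a \<Rightarrow> 'e) \<Rightarrow> ('a \<Rightarrow> 'e) \<Rightarrow>
     'a \<times> 'e \<Rightarrow> 'e \<times> 'e" where
  "abn_field A f0 f1 f2 l =
     ham_vf A (ham f0) l
     + (ham_bracket A f0 f2 l / ham_bracket A f2 f1 l) *\<^sub>R ham_vf A (ham f1) l
     + (ham_bracket A f1 f0 l / ham_bracket A f2 f1 l) *\<^sub>R ham_vf A (ham f2) l"

definition Abn ::
  "('a, 'e::euclidean_space) chart set \<Rightarrow> ('a \<Rightarrow> 'e) \<Rightarrow> ('a \<Rightarrow> 'e) \<Rightarrow> ('a \<Rightarrow> 'e) \<Rightarrow> 'a \<Rightarrow> 'e set" where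
  "Abn A f0 f1 f2 q =
     {proj_deriv (abn_field A f0 f1 f2 (q, p)) |p.
        (q, p) \<in> annihilator (D3 f0 f1 f2) - annihilator (dist_square A (D2 f1 f2))}"

text \<open>
  The reduction is determined only through its admissible velocities, so the scalar-input system
  \<open>(g0, g1)\<close> is a reduction when it has \<open>Abn\<close> as its sets of admissible velocities.
\<close>

definition has_reduction ::
  "('a, 'e::euclidean_space) chart set \<Rightarrow> ('a \<Rightarrow> 'e) \<Rightarrow> ('a \<Rightarrow> 'e) \<Rightarrow> ('a \<Rightarrow> 'e) \<Rightarrow>
     ('a \<Rightarrow> 'e) \<Rightarrow> ('a \<Rightarrow> 'e) \<Rightarrow> bool" where
  "has_reduction A f0 f1 f2 g0 g1 \<longleftrightarrow>
     (\<forall>q. dim (set_plus_pt (dist_square A (D2 f1 f2)) (D3 f0 f1 f2) q) = 4 \<and>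
          dim (dist_square A (D3 f0 f1 f2) q) = 5) \<and>
     (\<forall>q. Abn A f0 f1 f2 q = {g0 q + u *\<^sub>R g1 q |u. u \<in> (UNIV :: real set)})"

end

theory Submission
  imports Defs
begin

text \<open>
  For a covector \<open>p\<close> annihilating \<open>f0, f1, f2\<close>, the form \<open>(X, Y) \<mapsto> p \<bullet> [X, Y]\<close> on \<open>D3\<close> is tensorial,
  and the abnormal velocity of \<open>p\<close> is the admissible velocity spanning its kernel; hence \<open>Abn\<close> is
  invariant under feedback. For the normal form with third field \<open>\<alpha> g0 + [g0, g1]\<close>, the covector
  \<open>p\<close> also annihilates \<open>[g0, g1]\<close>, so the velocity is \<open>g0 + u g1\<close> with \<open>u\<close> a ratio of the values of
  \<open>p\<close> on the two second-order brackets, which is arbitrary. Conversely, if the velocities are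
  \<open>g0 + u g1\<close>, then every \<open>u\<close> comes from some \<open>p\<close> whose form vanishes on \<open>(g0 + u g1, g1)\<close>, that is
  \<open>p \<bullet> [g0, g1] = 0\<close>. The covectors for \<open>u = 0\<close> and \<open>u = 1\<close> span the annihilator of \<open>D3\<close>, so
  \<open>[g0, g1]\<close> is a section of \<open>D3\<close>, and \<open>D2\<close> is spanned by \<open>g1\<close> and \<open>\<alpha> g0 + [g0, g1]\<close>.
\<close>

section \<open>Calculus of smooth functions\<close>

text \<open>Two obstacles shape the development. A reduction is given by its velocity sets alone, so
  the converse yields covectors and feedback coefficients point by point, with no regularity in the
  point. Smoothness is recovered afterwards: components of a smooth field in a smooth frame are
  smooth by Cramer's rule. The other obstacle is that a bracket at a point is computed in the chart
  fixed at that point, and this chart may jump from point to point. Before a bracket can be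
  bracketed again it must be shown to be a vector field, which rests on chart independence and hence
  on symmetry of second derivatives.

  The hypothesis on the five fields is decisive in two places: it allows a covector with prescribed
  values on all five, and it gives \<open>g1 q \<noteq> 0\<close>, which makes the covectors for u =
  0 and u = 1 independent. As D3 has rank 3 in dimension 5, two independent covectors fill its
  annihilator.\<close>

lemma Ck_on_cong:
  assumes "open S" "\<And>x. x \<in> S \<Longrightarrow> f x = g x"
  shows "Ck_on k S f \<longleftrightarrow> Ck_on k S g"
proof -
  have "Ck_on k S g" if "open S" "\<forall>x\<in>S. f x = g x" "Ck_on k S f"
    for f g :: "'a \<Rightarrow> 'b" and k
    using that
  proof (induction k arbitrary: f g)
    case 0
    then show ?case using continuous_on_cong[of S S f g] by auto
  next
    case (Suc k)
    \<comment> \<open>Since \<open>S\<close> is open, the derivative at a point of \<open>S\<close>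
      is determined by the values on \<open>S\<close>.\<close>
    have d: "(g has_derivative frechet_derivative f (at x)) (at x)" if "x \<in> S" for x
      using Suc.prems that
      by (metis (no_types, lifting) Ck_on.simps(2) frechet_derivative_works
          has_derivative_transform_within_open)
    have "frechet_derivative g (at x) = frechet_derivative f (at x)" if "x \<in> S" for x
      using frechet_derivative_at[OF d[OF that]] by simp
    then have "Ck_on k S (\<lambda>x. frechet_derivative g (at x) v)" for v
      using Suc.IH[of "\<lambda>x. frechet_derivative f (at x) v"] Suc.prems by auto
    then show ?case
      using d by (auto intro: differentiableI)
  qed
  from this[of f g] this[of g f] show ?thesis
    using assms by auto
qed

lemma Ck_on_SucI:
  assumes "open S" "\<And>x. x \<in> S \<Longrightarrow> (f has_derivative f' x) (at x)"
    "\<And>v. Ck_on k S (\<lambda>x. f' x v)"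
  shows "Ck_on (Suc k) S f"
proof -
  have "frechet_derivative f (at x) = f' x" if "x \<in> S" for x
    using frechet_derivative_at[OF assms(2)[OF that]] by simp
  then have "Ck_on k S (\<lambda>x. frechet_derivative f (at x) v)" for v
    by (intro Ck_on_cong[THEN iffD1, OF assms(1) _ assms(3)]) simp
  then show ?thesis
    using assms(2) by (auto intro: differentiableI)
qed

lemma Ck_on_SucD:
  assumes "Ck_on (Suc k) S f"
  shows "x \<in> S \<Longrightarrow> (f has_derivative frechet_derivative f (at x)) (at x)"
    and "Ck_on k S (\<lambda>x. frechet_derivative f (at x) v)"
  using assms frechet_derivative_works by auto

lemma Ck_on_Suc_imp: "Ck_on (Suc k) S f \<Longrightarrow> Ck_on k S f"
proof (induction k arbitrary: f)
  case 0
  then show ?case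
    by (auto intro!: continuous_at_imp_continuous_on differentiable_imp_continuous_within)
next
  case (Suc k)
  have "Ck_on k S (\<lambda>x. frechet_derivative f (at x) v)" for v
    using Suc.IH Suc.prems by simp
  then show ?case
    using Suc.prems by simp
qed

lemma Ck_on_const: "Ck_on k S (\<lambda>x. c)"
proof (induction k arbitrary: c)
  case (Suc k)
  then show ?case by simp
qed simp

lemma Ck_on_subset: "Ck_on k S f \<Longrightarrow> T \<subseteq> S \<Longrightarrow> Ck_on k T f"
proof (induction k arbitrary: f)
  case 0
  then show ?case by (auto intro: continuous_on_subset)
next
  case (Suc k)
  then show ?case by auto
qed

lemma Ck_on_add:
  assumes "open S"
  shows "Ck_on k S f \<Longrightarrow> Ck_on k S g \<Longrightarrow> Ck_on k S (\<lambda>x. f x + g x)"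
proof (induction k arbitrary: f g)
  case 0
  then show ?case by (auto intro: continuous_intros)
next
  case (Suc k)
  show ?case
    by (rule Ck_on_SucI[OF assms, where f' =
          "\<lambda>x v. frechet_derivative f (at x) v + frechet_derivative g (at x) v"])
      (auto intro!: has_derivative_add Suc.IH Ck_on_SucD[OF Suc.prems(1)] Ck_on_SucD[OF Suc.prems(2)])
qed

text \<open>One induction covers products, scaling and inner products. The product rule leaves one
  factor undifferentiated in each summand, and that factor has to be lowered from class k+1 to class
  k.\<close>

lemma (in bounded_bilinear) Ck_on:
  assumes "open S"
  shows "Ck_on k S f \<Longrightarrow> Ck_on k S g \<Longrightarrow> Ck_on k S (\<lambda>x. prod (f x) (g x))"
proof (induction k arbitrary: f g)
  case 0
  then show ?case by (auto intro: continuous_on)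
next
  case (Suc k)
  show ?case
    by (rule Ck_on_SucI[OF assms, where f' = "\<lambda>x v. prod (f x) (frechet_derivative g (at x) v) +
          prod (frechet_derivative f (at x) v) (g x)"])
      (auto intro!: FDERIV Ck_on_add assms Suc.IH Ck_on_SucD[OF Suc.prems(1)]
        Ck_on_SucD[OF Suc.prems(2)] Ck_on_Suc_imp[OF Suc.prems(1)] Ck_on_Suc_imp[OF Suc.prems(2)])
qed

lemma Ck_on_sum:
  assumes "open S" "\<And>i. i \<in> I \<Longrightarrow> Ck_on k S (f i)"
  shows "Ck_on k S (\<lambda>x. \<Sum>i\<in>I. f i x)"
  using assms(2)
  by (induction I rule: infinite_finite_induct)
    (auto intro!: Ck_on_const Ck_on_add assms(1))

text \<open>The derivative of 1/f is -f'/f^2, which contains 1/f again but one order lower, so the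
  induction hypothesis applies to it.\<close>

lemma Ck_on_inverse:
  fixes f :: "'a::euclidean_space \<Rightarrow> real"
  assumes "open S" "\<And>x. x \<in> S \<Longrightarrow> f x \<noteq> 0"
  shows "Ck_on k S f \<Longrightarrow> Ck_on k S (\<lambda>x. inverse (f x))"
proof (induction k)
  case 0
  then show ?case using assms by (auto intro!: continuous_intros)
next
  case (Suc k)
  have "Ck_on k S (\<lambda>x. (- 1) * (inverse (f x) * frechet_derivative f (at x) v * inverse (f x)))" for v
    by (intro bounded_bilinear.Ck_on[OF bounded_bilinear_mult] Ck_on_const assms Suc
        Ck_on_SucD(2)[OF Suc.prems] Ck_on_Suc_imp[OF Suc.prems])
  moreover have "((\<lambda>x. inverse (f x)) has_derivative
      (\<lambda>v. - (inverse (f x) * frechet_derivative f (at x) v * inverse (f x)))) (at x)" if "x \<in> S" for x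
    by (intro Deriv.has_derivative_inverse Ck_on_SucD[OF Suc.prems] that assms)
  ultimately show ?case
    by (intro Ck_on_SucI[OF assms(1), where f = "\<lambda>x. inverse (f x)" and
        f' = "\<lambda>x v. - (inverse (f x) * frechet_derivative f (at x) v * inverse (f x))"])
      (simp_all del: Ck_on.simps)
qed

lemma linear_sum_Basis:
  fixes f :: "'a::euclidean_space \<Rightarrow> 'b::real_vector"
  assumes "linear f"
  shows "f v = (\<Sum>b\<in>Basis. (v \<bullet> b) *\<^sub>R f b)"
  by (subst euclidean_representation[symmetric, of v])
    (simp add: linear_sum[OF assms] linear_scale[OF assms])

section \<open>Closure properties of smooth functions\<close>

lemma smooth_on_cong:
  assumes "open S" "\<And>x. x \<in> S \<Longrightarrow> f x = g x"
  shows "smooth_on S f \<longleftrightarrow> smooth_on S g"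
proof -
  have "Ck_on k S f \<longleftrightarrow> Ck_on k S g" for k
    by (rule Ck_on_cong) (use assms in auto)
  then show ?thesis by (simp add: smooth_on_def)
qed

lemma smooth_on_const: "smooth_on S (\<lambda>x. c)"
  by (simp add: smooth_on_def Ck_on_const)

lemma smooth_on_subset: "smooth_on S f \<Longrightarrow> T \<subseteq> S \<Longrightarrow> smooth_on T f"
  unfolding smooth_on_def by (blast intro: Ck_on_subset)

lemma smooth_on_add:
  "open S \<Longrightarrow> smooth_on S f \<Longrightarrow> smooth_on S g \<Longrightarrow> smooth_on S (\<lambda>x. f x + g x)"
  by (simp add: smooth_on_def Ck_on_add)

lemma (in bounded_bilinear) smooth_on:
  "open S \<Longrightarrow> smooth_on S f \<Longrightarrow> smooth_on S g \<Longrightarrow> smooth_on S (\<lambda>x. prod (f x) (g x))"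
  by (simp add: smooth_on_def Ck_on)

lemmas smooth_on_mult = bounded_bilinear.smooth_on[OF bounded_bilinear_mult]
lemmas smooth_on_scaleR = bounded_bilinear.smooth_on[OF bounded_bilinear_scaleR]
lemmas smooth_on_inner = bounded_bilinear.smooth_on[OF bounded_bilinear_inner]

lemma smooth_on_sum:
  "open S \<Longrightarrow> (\<And>i. i \<in> I \<Longrightarrow> smooth_on S (f i)) \<Longrightarrow> smooth_on S (\<lambda>x. \<Sum>i\<in>I. f i x)"
  by (simp add: smooth_on_def Ck_on_sum)

lemma smooth_on_prod:
  fixes f :: "'i \<Rightarrow> 'a::euclidean_space \<Rightarrow> real"
  assumes "open S" "\<And>i. i \<in> I \<Longrightarrow> smooth_on S (f i)"
  shows "smooth_on S (\<lambda>x. \<Prod>i\<in>I. f i x)"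
  using assms(2)
  by (induction I rule: infinite_finite_induct)
    (auto intro!: smooth_on_const smooth_on_mult assms(1))

lemma smooth_on_minus:
  "open S \<Longrightarrow> smooth_on S f \<Longrightarrow> smooth_on S (\<lambda>x. - f x)"
  using smooth_on_scaleR[of S "\<lambda>x. - 1" f] smooth_on_const by auto

lemma smooth_on_diff:
  "open S \<Longrightarrow> smooth_on S f \<Longrightarrow> smooth_on S g \<Longrightarrow> smooth_on S (\<lambda>x. f x - g x)"
  using smooth_on_add[of S f "\<lambda>x. - g x"] smooth_on_minus by auto

lemma smooth_on_divide:
  fixes f g :: "'a::euclidean_space \<Rightarrow> real"
  assumes "open S" "smooth_on S f" "smooth_on S g" "\<And>x. x \<in> S \<Longrightarrow> g x \<noteq> 0"
  shows "smooth_on S (\<lambda>x. f x / g x)"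
proof -
  have "smooth_on S (\<lambda>x. f x * inverse (g x))"
    using assms by (intro smooth_on_mult) (auto simp: smooth_on_def Ck_on_inverse)
  then show ?thesis by (simp add: divide_inverse)
qed

lemma smooth_on_imp_has_derivative:
  "smooth_on S f \<Longrightarrow> x \<in> S \<Longrightarrow> (f has_derivative frechet_derivative f (at x)) (at x)"
  unfolding smooth_on_def by (rule Ck_on_SucD(1)[of 0]) auto

lemma smooth_on_imp_linear:
  "smooth_on S f \<Longrightarrow> x \<in> S \<Longrightarrow> linear (frechet_derivative f (at x))"
  using smooth_on_imp_has_derivative has_derivative_linear by blast

lemma smooth_on_imp_continuous_on: "smooth_on S f \<Longrightarrow> continuous_on S f"
  unfolding smooth_on_def using Ck_on.simps(1) by blast

lemma smooth_on_frechet_derivative: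
  "smooth_on S f \<Longrightarrow> smooth_on S (\<lambda>x. frechet_derivative f (at x) v)"
  unfolding smooth_on_def using Ck_on_SucD(2) by blast

text \<open>Smoothness of a derivative is built into the definition only for a fixed direction;
  expanding the moving direction \<open>X x\<close> in the basis reduces to that case.\<close>

lemma smooth_on_directional_derivative:
  fixes f :: "'a::euclidean_space \<Rightarrow> 'b::real_normed_vector"
  assumes "open S" "smooth_on S f" "smooth_on S X"
  shows "smooth_on S (\<lambda>x. frechet_derivative f (at x) (X x))"
proof -
  have "smooth_on S (\<lambda>x. \<Sum>b\<in>Basis. (X x \<bullet> b) *\<^sub>R frechet_derivative f (at x) b)"
    by (intro smooth_on_sum smooth_on_scaleR smooth_on_inner smooth_on_const
        smooth_on_frechet_derivative assms)
  then show ?thesis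
    by (rule smooth_on_cong[THEN iffD1, rotated 2])
      (simp_all add: assms(1) linear_sum_Basis[symmetric] smooth_on_imp_linear[OF assms(2)])
qed

text \<open>The mean value theorem is applied twice. What matters later is that the left-hand side
  is symmetric in \<open>u\<close> and \<open>v\<close>, whereas the right-hand side differentiates
  in a definite order.\<close>

lemma second_difference_mean_value:
  fixes f :: "'a::euclidean_space \<Rightarrow> real"
  assumes f: "smooth_on S f" and "h > 0"
    and S: "\<And>s t. 0 \<le> s \<Longrightarrow> s \<le> h \<Longrightarrow> 0 \<le> t \<Longrightarrow> t \<le> h \<Longrightarrow> x + s *\<^sub>R u + t *\<^sub>R v \<in> S"
  obtains s t where "0 \<le> s" "s \<le> h" "0 \<le> t" "t \<le> h"
    "f (x + h *\<^sub>R u + h *\<^sub>R v) - f (x + h *\<^sub>R u) - f (x + h *\<^sub>R v) + f x =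
      h * (h * frechet_derivative (\<lambda>y. frechet_derivative f (at y) u)
        (at (x + s *\<^sub>R u + t *\<^sub>R v)) v)"
proof -
  let ?D = "\<lambda>y. frechet_derivative f (at y) u"
  have dv: "((\<lambda>\<tau>. g (z + \<tau> *\<^sub>R w)) has_real_derivative
      frechet_derivative g (at (z + \<tau> *\<^sub>R w)) w) (at \<tau>)"
    if "smooth_on S g" "z + \<tau> *\<^sub>R w \<in> S" for g :: "'a \<Rightarrow> real" and z w \<tau>
  proof -
    have "((\<lambda>\<tau>. g (z + \<tau> *\<^sub>R w)) has_derivative
        (\<lambda>r. frechet_derivative g (at (z + \<tau> *\<^sub>R w)) (r *\<^sub>R w))) (at \<tau>)"
      by (rule has_derivative_compose[where f = "\<lambda>\<tau>. z + \<tau> *\<^sub>R w" and g = g,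
            OF _ smooth_on_imp_has_derivative[OF that]])
        (auto intro!: derivative_eq_intros)
    then show ?thesis
      by (rule has_derivative_imp_has_field_derivative)
        (simp add: linear_scale[OF smooth_on_imp_linear[OF that]])
  qed
  \<comment> \<open>This application runs along \<open>u\<close> and concerns the difference of
    \<open>f\<close> on two opposite sides of the parallelogram; the next runs along
    \<open>v\<close> and concerns the derivative in direction \<open>u\<close>.\<close>
  have "((\<lambda>s. f ((x + h *\<^sub>R v) + s *\<^sub>R u) - f (x + s *\<^sub>R u)) has_real_derivative
      ?D ((x + h *\<^sub>R v) + s *\<^sub>R u) - ?D (x + s *\<^sub>R u)) (at s)" if "0 \<le> s" "s \<le> h" for s
  proof (rule DERIV_diff[OF dv[OF f, of "x + h *\<^sub>R v" s u] dv[OF f, of x s u]])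
    show "x + h *\<^sub>R v + s *\<^sub>R u \<in> S" "x + s *\<^sub>R u \<in> S"
      using S[of s h] S[of s 0] that \<open>h > 0\<close> by (simp_all add: add.commute add.left_commute)
  qed
  from MVT2[OF \<open>h > 0\<close>, where f = "\<lambda>s. f ((x + h *\<^sub>R v) + s *\<^sub>R u) - f (x + s *\<^sub>R u)", OF this]
  obtain s where s: "0 < s" "s < h" and
    1: "f ((x + h *\<^sub>R v) + h *\<^sub>R u) - f (x + h *\<^sub>R u) - (f (x + h *\<^sub>R v) - f x) =
        h * (?D ((x + h *\<^sub>R v) + s *\<^sub>R u) - ?D (x + s *\<^sub>R u))"
    by auto
  have "((\<lambda>t. ?D ((x + s *\<^sub>R u) + t *\<^sub>R v)) has_real_derivative
      frechet_derivative ?D (at ((x + s *\<^sub>R u) + t *\<^sub>R v)) v) (at t)" if "0 \<le> t" "t \<le> h" for t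
    by (rule dv[OF smooth_on_frechet_derivative[OF f, of u], of "x + s *\<^sub>R u" t v])
      (rule S; use s that in simp)
  from MVT2[OF \<open>h > 0\<close>, where f = "\<lambda>t. ?D ((x + s *\<^sub>R u) + t *\<^sub>R v)", OF this]
  obtain t where t: "0 < t" "t < h" and
    2: "?D ((x + s *\<^sub>R u) + h *\<^sub>R v) - ?D (x + s *\<^sub>R u) =
        h * frechet_derivative ?D (at ((x + s *\<^sub>R u) + t *\<^sub>R v)) v"
    by auto
  show thesis
  proof (rule that[of s t])
    have "?D ((x + h *\<^sub>R v) + s *\<^sub>R u) = ?D ((x + s *\<^sub>R u) + h *\<^sub>R v)"
      by (simp add: add_ac)
    with 1 2 show "f (x + h *\<^sub>R u + h *\<^sub>R v) - f (x + h *\<^sub>R u) - f (x + h *\<^sub>R v) + f x =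
      h * (h * frechet_derivative ?D (at (x + s *\<^sub>R u + t *\<^sub>R v)) v)"
      by (simp add: add_ac)
  qed (use s t in simp_all)
qed

text \<open>Schwarz's theorem: evaluating the symmetric second difference in both orders and
  cancelling h^2 equates the two mixed derivatives at two points near \<open>x\<close>, and
  continuity of both carries the equality to \<open>x\<close>.\<close>

lemma frechet_derivative_commute_real:
  fixes f :: "'a::euclidean_space \<Rightarrow> real"
  assumes "open S" "smooth_on S f" "x \<in> S"
  shows "frechet_derivative (\<lambda>y. frechet_derivative f (at y) u) (at x) v =
    frechet_derivative (\<lambda>y. frechet_derivative f (at y) v) (at x) u"
proof -
  define P where "P y = frechet_derivative (\<lambda>y. frechet_derivative f (at y) u) (at y) v" for y
  define Q where "Q y = frechet_derivative (\<lambda>y. frechet_derivative f (at y) v) (at y) u" for y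
  have cont: "continuous_on S P" "continuous_on S Q"
    unfolding P_def Q_def by (intro smooth_on_imp_continuous_on smooth_on_frechet_derivative assms)+
  have "dist (P x) (Q x) \<le> e" if "e > 0" for e
  proof -
    have e: "e / 2 > 0" using that by simp
    from cont(1) assms obtain d1 where d1: "d1 > 0"
      "\<And>y. y \<in> S \<Longrightarrow> dist y x < d1 \<Longrightarrow> dist (P y) (P x) < e / 2"
      unfolding continuous_on_iff using e by meson
    from cont(2) assms obtain d2 where d2: "d2 > 0"
      "\<And>y. y \<in> S \<Longrightarrow> dist y x < d2 \<Longrightarrow> dist (Q y) (Q x) < e / 2"
      unfolding continuous_on_iff using e by meson
    obtain d3 where d3: "d3 > 0" "\<And>y. dist y x < d3 \<Longrightarrow> y \<in> S"
      using assms open_dist by metis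
    define d where "d = min d1 (min d2 d3)"
    have "d > 0" using d1 d2 d3 by (simp add: d_def)
    \<comment> \<open>Points of the parallelogram lie within h (|u| + |v|) of \<open>x\<close>; the
      summand 1 makes this strictly less than \<open>d\<close> and keeps the denominator positive
      when \<open>u\<close> and \<open>v\<close> vanish.\<close>
    define h where "h = d / (norm u + norm v + 1)"
    have n: "norm u + norm v + 1 > 0" using norm_ge_zero[of u] norm_ge_zero[of v] by linarith
    have "h > 0" using \<open>d > 0\<close> n by (simp add: h_def)
    have near: "dist (x + s *\<^sub>R u + t *\<^sub>R v) x < d"
      if "0 \<le> s" "s \<le> h" "0 \<le> t" "t \<le> h" for s t
    proof -
      have "dist (x + s *\<^sub>R u + t *\<^sub>R v) x \<le> norm (s *\<^sub>R u) + norm (t *\<^sub>R v)"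
        unfolding dist_norm by (metis add.assoc add_diff_cancel_left' norm_triangle_ineq)
      also have "\<dots> \<le> h * norm u + h * norm v"
        using that by (auto intro!: add_mono mult_right_mono)
      also have "\<dots> < h * (norm u + norm v + 1)"
        using \<open>h > 0\<close> by (simp add: algebra_simps)
      finally show ?thesis using n by (simp add: h_def)
    qed
    have inS: "x + s *\<^sub>R u + t *\<^sub>R v \<in> S"
      if "0 \<le> s" "s \<le> h" "0 \<le> t" "t \<le> h" for s t
      using near[OF that] d3(2) by (simp add: d_def)
    have inS': "x + t *\<^sub>R v + s *\<^sub>R u \<in> S"
      if "0 \<le> t" "t \<le> h" "0 \<le> s" "s \<le> h" for s t
      using inS[OF that(3,4,1,2)] by (simp add: add_ac)
    obtain s t where st: "0 \<le> s" "s \<le> h" "0 \<le> t" "t \<le> h"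
      and 1: "f (x + h *\<^sub>R u + h *\<^sub>R v) - f (x + h *\<^sub>R u) - f (x + h *\<^sub>R v) + f x =
        h * (h * P (x + s *\<^sub>R u + t *\<^sub>R v))"
      unfolding P_def by (rule second_difference_mean_value[OF assms(2) \<open>h > 0\<close> inS])
    obtain t' s' where st': "0 \<le> t'" "t' \<le> h" "0 \<le> s'" "s' \<le> h"
      and 2: "f (x + h *\<^sub>R v + h *\<^sub>R u) - f (x + h *\<^sub>R v) - f (x + h *\<^sub>R u) + f x =
        h * (h * Q (x + t' *\<^sub>R v + s' *\<^sub>R u))"
      unfolding Q_def by (rule second_difference_mean_value[OF assms(2) \<open>h > 0\<close> inS'])
    have "h * (h * P (x + s *\<^sub>R u + t *\<^sub>R v)) = h * (h * Q (x + t' *\<^sub>R v + s' *\<^sub>R u))"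
      unfolding 1[symmetric] 2[symmetric] by (simp add: algebra_simps)
    then have eq: "P (x + s *\<^sub>R u + t *\<^sub>R v) = Q (x + s' *\<^sub>R u + t' *\<^sub>R v)"
      using \<open>h > 0\<close> by (simp add: algebra_simps)
    have "dist (P (x + s *\<^sub>R u + t *\<^sub>R v)) (P x) < e / 2"
      "dist (Q (x + s' *\<^sub>R u + t' *\<^sub>R v)) (Q x) < e / 2"
      using d1(2)[OF inS[OF st]] near[OF st] d2(2)[OF inS[OF st'(3,4,1,2)]] near[OF st'(3,4,1,2)]
      unfolding d_def by linarith+
    then show ?thesis
      unfolding eq using dist_triangle3[of "P x" "Q x" "Q (x + s' *\<^sub>R u + t' *\<^sub>R v)"]
      by linarith
  qed
  then have "dist (P x) (Q x) \<le> 0"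
    using field_le_epsilon[of "dist (P x) (Q x)" 0] by simp
  then show ?thesis by (simp add: P_def Q_def)
qed

lemma frechet_derivative_inner_const:
  assumes "f differentiable (at x)"
  shows "frechet_derivative (\<lambda>y. f y \<bullet> b) (at x) v = frechet_derivative f (at x) v \<bullet> b"
proof -
  have "((\<lambda>y. f y \<bullet> b) has_derivative (\<lambda>v. frechet_derivative f (at x) v \<bullet> b)) (at x)"
    using assms by (auto intro!: derivative_eq_intros simp: frechet_derivative_works)
  then show ?thesis
    using frechet_derivative_at by metis
qed

lemma frechet_derivative_commute:
  fixes f :: "'a::euclidean_space \<Rightarrow> 'b::euclidean_space"
  assumes "open S" "smooth_on S f" "x \<in> S"
  shows "frechet_derivative (\<lambda>y. frechet_derivative f (at y) u) (at x) v =
    frechet_derivative (\<lambda>y. frechet_derivative f (at y) v) (at x) u"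
proof (rule euclidean_eqI)
  fix b :: 'b assume "b \<in> Basis"
  have *: "frechet_derivative (\<lambda>y. frechet_derivative f (at y) u) (at x) v \<bullet> b =
    frechet_derivative (\<lambda>y. frechet_derivative (\<lambda>z. f z \<bullet> b) (at y) u) (at x) v" for u v
  proof -
    have d: "g differentiable (at y)" if "smooth_on S g" "y \<in> S" for g :: "'a \<Rightarrow> 'b" and y
      using smooth_on_imp_has_derivative[OF that] by (rule differentiableI)
    have "frechet_derivative (\<lambda>y. frechet_derivative f (at y) u) (at x) v \<bullet> b =
      frechet_derivative (\<lambda>y. frechet_derivative f (at y) u \<bullet> b) (at x) v"
      by (intro frechet_derivative_inner_const[symmetric] d smooth_on_frechet_derivative assms)
    also have "\<dots> = frechet_derivative (\<lambda>y. frechet_derivative (\<lambda>z. f z \<bullet> b) (at y) u) (at x) v"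
    proof (rule fun_cong[of _ _ v], rule frechet_derivative_transform_within_open[of _ _ S])
      show "(\<lambda>y. frechet_derivative f (at y) u \<bullet> b) differentiable (at x)"
        by (rule differentiableI[OF smooth_on_imp_has_derivative[OF smooth_on_inner]])
          (fact assms smooth_on_const smooth_on_frechet_derivative[OF assms(2)])+
      show "frechet_derivative f (at y) u \<bullet> b = frechet_derivative (\<lambda>z. f z \<bullet> b) (at y) u" if "y \<in> S" for y
        by (rule frechet_derivative_inner_const[symmetric]) (rule d[OF assms(2) that])
    qed (fact assms)+
    finally show ?thesis .
  qed
  show "frechet_derivative (\<lambda>y. frechet_derivative f (at y) u) (at x) v \<bullet> b =
    frechet_derivative (\<lambda>y. frechet_derivative f (at y) v) (at x) u \<bullet> b"
    unfolding * by (rule frechet_derivative_commute_real[OF assms(1) _ assms(3)])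
      (fact smooth_on_inner[OF assms(1,2) smooth_on_const])
qed

lemma smooth_on_det:
  fixes M :: "'a::euclidean_space \<Rightarrow> real^'k^'k"
  assumes "open S" "\<And>i j. smooth_on S (\<lambda>x. M x $ i $ j)"
  shows "smooth_on S (\<lambda>x. det (M x))"
  unfolding det_def
  by (rule smooth_on_sum[OF assms(1)])
    (rule smooth_on_mult[OF assms(1) smooth_on_const smooth_on_prod[OF assms]])

text \<open>
  The coefficients solve the linear system whose matrix is the Gram matrix of the frame, so
  Cramer's rule expresses them as smooth functions.
\<close>

lemma smooth_on_frame_coefficients:
  fixes F :: "'k::finite \<Rightarrow> 'a::euclidean_space \<Rightarrow> 'b::euclidean_space"
  assumes S: "open S" and F: "\<And>i. smooth_on S (F i)"
    and indep: "\<And>x c. x \<in> S \<Longrightarrow> (\<Sum>i\<in>UNIV. c i *\<^sub>R F i x) = 0 \<Longrightarrow> c = (\<lambda>i. 0)"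
    and X: "smooth_on S (\<lambda>x. \<Sum>i\<in>UNIV. a i x *\<^sub>R F i x)"
  shows "smooth_on S (a k)"
proof -
  define X' where "X' x = (\<Sum>i\<in>UNIV. a i x *\<^sub>R F i x)" for x
  define G :: "'a \<Rightarrow> real^'k^'k" where "G x = (\<chi> i j. F i x \<bullet> F j x)" for x
  have G: "G x *v v = (\<chi> i. F i x \<bullet> (\<Sum>j\<in>UNIV. (v $ j) *\<^sub>R F j x))" for x v
    by (simp add: G_def matrix_vector_mult_def inner_sum_right mult.commute)
  have det: "det (G x) \<noteq> 0" if "x \<in> S" for x
  proof -
    have "v = 0" if "G x *v v = 0" for v
    proof -
      let ?w = "\<Sum>j\<in>UNIV. (v $ j) *\<^sub>R F j x"
      have "F i x \<bullet> ?w = 0" for i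
        using that unfolding G by (simp add: vec_eq_iff)
      \<comment> \<open>\<open>?w\<close> is orthogonal to every \<open>F i x\<close> and is itself
        a combination of them.\<close>
      then have "?w \<bullet> ?w = 0"
        by (subst inner_sum_left) simp
      then have "?w = 0" by simp
      from indep[OF \<open>x \<in> S\<close> this] show "v = 0"
        by (simp add: vec_eq_iff fun_eq_iff)
    qed
    then show ?thesis
      by (metis invertible_det_nz invertible_left_inverse matrix_left_invertible_ker)
  qed
  have a: "a k x = det (\<chi> i j. if j = k then F i x \<bullet> X' x else G x $ i $ j) / det (G x)"
    if "x \<in> S" for x
  proof -
    have "G x *v (\<chi> i. a i x) = (\<chi> i. F i x \<bullet> X' x)"
      unfolding G X'_def by simp
    then have "(\<chi> i. a i x) = (\<chi> k. det (\<chi> i j. if j = k then (\<chi> i. F i x \<bullet> X' x) $ i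
        else G x $ i $ j) / det (G x))"
      using cramer[OF det[OF that]] by blast
    then show ?thesis by (simp add: vec_eq_iff cong: if_cong)
  qed
  have "smooth_on S (\<lambda>x. G x $ i $ j)" for i j
    by (simp add: G_def smooth_on_inner[OF S F F])
  moreover have "smooth_on S (\<lambda>x. F i x \<bullet> X' x)" for i
    unfolding X'_def by (rule smooth_on_inner[OF S F X])
  ultimately have "smooth_on S (\<lambda>x. if j = k then F i x \<bullet> X' x else G x $ i $ j)" for i j
    by (cases "j = k") simp_all
  with \<open>\<And>i j. smooth_on S (\<lambda>x. G x $ i $ j)\<close> have "smooth_on S
      (\<lambda>x. det (\<chi> i j. if j = k then F i x \<bullet> X' x else G x $ i $ j) / det (G x))"
    by (intro smooth_on_divide smooth_on_det S det) simp_all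
  then show ?thesis
    by (subst smooth_on_cong[OF S a])
qed

section \<open>Lie brackets on a manifold\<close>

definition coord_bracket :: "('e::euclidean_space \<Rightarrow> 'e) \<Rightarrow> ('e \<Rightarrow> 'e) \<Rightarrow> 'e \<Rightarrow> 'e" where
  "coord_bracket X Y x = frechet_derivative Y (at x) (X x) - frechet_derivative X (at x) (Y x)"

lemma smooth_on_coord_bracket:
  "open S \<Longrightarrow> smooth_on S X \<Longrightarrow> smooth_on S Y \<Longrightarrow> smooth_on S (coord_bracket X Y)"
  unfolding coord_bracket_def[abs_def]
  by (intro smooth_on_diff smooth_on_directional_derivative)

text \<open>Related fields have related brackets. Differentiating
  \<open>X' (\<phi> y) = D\<phi> (X y)\<close> produces, besides the expected term, the second
  derivative of \<phi> applied to \<open>X\<close> and the direction; by symmetry these terms cancel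
  in the bracket.\<close>

lemma coord_bracket_naturality:
  fixes \<phi> :: "'a::euclidean_space \<Rightarrow> 'b::euclidean_space"
  assumes U: "open U" and V: "open V" and \<phi>: "smooth_on U \<phi>" and UV: "\<phi> ` U \<subseteq> V"
    and X: "smooth_on U X" and Y: "smooth_on U Y"
    and X': "smooth_on V X'" and Y': "smooth_on V Y'"
    and relX: "\<And>y. y \<in> U \<Longrightarrow> X' (\<phi> y) = frechet_derivative \<phi> (at y) (X y)"
    and relY: "\<And>y. y \<in> U \<Longrightarrow> Y' (\<phi> y) = frechet_derivative \<phi> (at y) (Y y)"
    and x: "x \<in> U"
  shows "coord_bracket X' Y' (\<phi> x) = frechet_derivative \<phi> (at x) (coord_bracket X Y x)"
proof -
  let ?D = "\<lambda>y. frechet_derivative \<phi> (at y)"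
  let ?D2 = "\<lambda>u v. frechet_derivative (\<lambda>y. ?D y u) (at x) v"
  have lin: "linear (?D y)" if "y \<in> U" for y
    by (rule smooth_on_imp_linear[OF \<phi> that])
  have lin2: "linear (?D2 u)" for u
    by (rule smooth_on_imp_linear[OF smooth_on_frechet_derivative[OF \<phi>] x])
  have key: "frechet_derivative Z' (at (\<phi> x)) (?D x w) =
      ?D x (frechet_derivative Z (at x) w) + (\<Sum>b\<in>Basis. (Z x \<bullet> b) *\<^sub>R ?D2 b w)"
    if Z: "smooth_on U Z" and Z': "smooth_on V Z'"
      and rel: "\<And>y. y \<in> U \<Longrightarrow> Z' (\<phi> y) = ?D y (Z y)" for Z and Z' :: "'b \<Rightarrow> 'b" and w
  proof -
    have "((\<lambda>y. Z' (\<phi> y)) has_derivative (\<lambda>w. frechet_derivative Z' (at (\<phi> x)) (?D x w))) (at x)"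
      by (rule has_derivative_compose[OF smooth_on_imp_has_derivative[OF \<phi> x]
            smooth_on_imp_has_derivative[OF Z']]) (use UV x in auto)
    \<comment> \<open>The same function is differentiated a second way: on \<open>U\<close> it
      equals \<open>?D y (Z y)\<close>, expanded in the basis so that the product rule exposes the
      second derivative of \<phi>.\<close>
    moreover have "((\<lambda>y. Z' (\<phi> y)) has_derivative (\<lambda>w. \<Sum>b\<in>Basis. (Z x \<bullet> b) *\<^sub>R ?D2 b w +
        (frechet_derivative Z (at x) w \<bullet> b) *\<^sub>R ?D x b)) (at x)"
    proof (rule has_derivative_transform_within_open[OF _ U x])
      show "((\<lambda>y. \<Sum>b\<in>Basis. (Z y \<bullet> b) *\<^sub>R ?D y b) has_derivative (\<lambda>w. \<Sum>b\<in>Basis.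
          (Z x \<bullet> b) *\<^sub>R ?D2 b w + (frechet_derivative Z (at x) w \<bullet> b) *\<^sub>R ?D x b)) (at x)"
        by (intro has_derivative_sum has_derivative_scaleR has_derivative_inner_left
            smooth_on_imp_has_derivative[OF Z x]
            smooth_on_imp_has_derivative[OF smooth_on_frechet_derivative[OF \<phi>] x])
      show "(\<Sum>b\<in>Basis. (Z y \<bullet> b) *\<^sub>R ?D y b) = Z' (\<phi> y)" if "y \<in> U" for y
        unfolding rel[OF that] by (rule linear_sum_Basis[OF lin[OF that], symmetric])
    qed
    ultimately have "frechet_derivative Z' (at (\<phi> x)) (?D x w) = (\<Sum>b\<in>Basis. (Z x \<bullet> b) *\<^sub>R ?D2 b w +
        (frechet_derivative Z (at x) w \<bullet> b) *\<^sub>R ?D x b)"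
      by (rule has_derivative_unique[THEN fun_cong])
    also have "\<dots> = ?D x (frechet_derivative Z (at x) w) + (\<Sum>b\<in>Basis. (Z x \<bullet> b) *\<^sub>R ?D2 b w)"
      by (subst (2) linear_sum_Basis[OF lin[OF x]]) (simp add: sum.distrib)
    finally show ?thesis .
  qed
  \<comment> \<open>Both arguments of the second derivative are expanded in the basis, so that
    commuting partial derivatives and swapping the sums exchanges \<open>X x\<close> and
    \<open>Y x\<close>.\<close>
  have "(\<Sum>b\<in>Basis. (Y x \<bullet> b) *\<^sub>R ?D2 b (X x)) =
      (\<Sum>b\<in>Basis. \<Sum>b'\<in>Basis. (Y x \<bullet> b) *\<^sub>R (X x \<bullet> b') *\<^sub>R ?D2 b b')"
    by (simp add: linear_sum_Basis[OF lin2, of _ "X x"] scaleR_sum_right)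
  also have "\<dots> = (\<Sum>b'\<in>Basis. \<Sum>b\<in>Basis. (X x \<bullet> b') *\<^sub>R (Y x \<bullet> b) *\<^sub>R ?D2 b' b)"
    by (subst sum.swap) (simp add: frechet_derivative_commute[OF U \<phi> x] mult.commute)
  also have "\<dots> = (\<Sum>b\<in>Basis. (X x \<bullet> b) *\<^sub>R ?D2 b (Y x))"
    by (simp add: linear_sum_Basis[OF lin2, of _ "Y x"] scaleR_sum_right)
  finally have "(\<Sum>b\<in>Basis. (Y x \<bullet> b) *\<^sub>R ?D2 b (X x)) = (\<Sum>b\<in>Basis. (X x \<bullet> b) *\<^sub>R ?D2 b (Y x))" .
  moreover have "frechet_derivative X' (at (\<phi> x)) (?D x w) =
      ?D x (frechet_derivative X (at x) w) + (\<Sum>b\<in>Basis. (X x \<bullet> b) *\<^sub>R ?D2 b w)"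
    "frechet_derivative Y' (at (\<phi> x)) (?D x w) =
      ?D x (frechet_derivative Y (at x) w) + (\<Sum>b\<in>Basis. (Y x \<bullet> b) *\<^sub>R ?D2 b w)" for w
    by (rule key[OF X X' relX] key[OF Y Y' relY], assumption)+
  ultimately show ?thesis
    unfolding coord_bracket_def relX[OF x] relY[OF x] by (simp add: linear_diff[OF lin[OF x]])
qed

section \<open>Charts, transition derivatives and coordinate representations\<close>

locale manifold =
  fixes A :: "('a::{t2_space,second_countable_topology}, 'e::euclidean_space) chart set"
  assumes atlas: "smooth_atlas A"
begin

lemma is_chart: "c \<in> A \<Longrightarrow> is_chart c"
  using atlas by (simp add: smooth_atlas_def)

lemma chart_at: "chart_at A q \<in> A" "q \<in> chart_dom (chart_at A q)"
proof -
  have "q \<in> (\<Union>c\<in>A. chart_dom c)"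
    using atlas by (simp add: smooth_atlas_def)
  then have "\<exists>c. c \<in> A \<and> q \<in> chart_dom c" by blast
  from someI_ex[OF this] show "chart_at A q \<in> A" "q \<in> chart_dom (chart_at A q)"
    by (simp_all add: chart_at_def)
qed

lemma open_chart_image: "c \<in> A \<Longrightarrow> open (chart_image c)"
  using is_chart by (simp add: is_chart_def)

lemma chart_homeomorphism:
  "c \<in> A \<Longrightarrow> homeomorphism (chart_dom c) (chart_image c) (coords c) (param c)"
  using is_chart by (simp add: is_chart_def)

lemma param_coords: "c \<in> A \<Longrightarrow> q \<in> chart_dom c \<Longrightarrow> param c (coords c q) = q"
  using chart_homeomorphism by (simp add: homeomorphism_def)

lemma coords_param: "c \<in> A \<Longrightarrow> x \<in> chart_image c \<Longrightarrow> coords c (param c x) = x"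
  using chart_homeomorphism by (simp add: homeomorphism_def)

lemma coords_in: "q \<in> chart_dom c \<Longrightarrow> coords c q \<in> chart_image c"
  by (simp add: chart_image_def)

lemma param_in: "c \<in> A \<Longrightarrow> x \<in> chart_image c \<Longrightarrow> param c x \<in> chart_dom c"
  using chart_homeomorphism unfolding homeomorphism_def by blast

lemma open_coords_image:
  assumes "c \<in> A" "open W"
  shows "open (coords c ` (chart_dom c \<inter> W))"
proof -
  have "openin (top_of_set (chart_dom c)) (chart_dom c \<inter> W)"
    using assms by (simp add: openin_open_Int)
  then show ?thesis
    using homeomorphism_imp_open_map[OF chart_homeomorphism[OF assms(1)]] openin_open_trans
      open_chart_image[OF assms(1)] by blast
qed

lemma open_chart_dom: "c \<in> A \<Longrightarrow> open (chart_dom c)"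
  using is_chart by (simp add: is_chart_def)

lemma smooth_transition:
  "c \<in> A \<Longrightarrow> d \<in> A \<Longrightarrow> smooth_on (coords c ` (chart_dom c \<inter> chart_dom d)) (coords d \<circ> param c)"
  using atlas by (simp add: smooth_atlas_def)

lemma transition_has_derivative:
  assumes "c \<in> A" "q \<in> chart_dom c"
  shows "((coords c \<circ> param (chart_at A q)) has_derivative transition_deriv A c q)
    (at (coords (chart_at A q) q))"
  unfolding transition_deriv_def
  by (rule smooth_on_imp_has_derivative[OF smooth_transition[OF chart_at(1)[of q] assms(1)]])
    (use assms chart_at[of q] in auto)

text \<open>The composite of transition maps agrees with the direct one only over the common domain
  of the three charts; its open image \<open>?W\<close> is the neighbourhood on which the chain rule
  is used.\<close>

lemma transition_deriv_chain:
  assumes "c \<in> A" "d \<in> A" "q \<in> chart_dom c" "q \<in> chart_dom d"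
  shows "transition_deriv A d q v =
    frechet_derivative (coords d \<circ> param c) (at (coords c q)) (transition_deriv A c q v)"
proof -
  let ?e = "chart_at A q"
  let ?W = "coords ?e ` (chart_dom ?e \<inter> (chart_dom c \<inter> chart_dom d))"
  have pc: "param ?e (coords ?e q) = q"
    by (rule param_coords) (use chart_at in auto)
  have "((coords d \<circ> param c) has_derivative frechet_derivative (coords d \<circ> param c) (at (coords c q)))
      (at (coords c q))"
    by (rule smooth_on_imp_has_derivative[OF smooth_transition[OF assms(1,2)]]) (use assms in auto)
  then have "(((coords d \<circ> param c) \<circ> (coords c \<circ> param ?e)) has_derivative
      (frechet_derivative (coords d \<circ> param c) (at (coords c q)) \<circ> transition_deriv A c q))
      (at (coords ?e q))"
    by (intro diff_chain_at transition_has_derivative assms) (simp add: pc)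
  then have "((coords d \<circ> param ?e) has_derivative
      (frechet_derivative (coords d \<circ> param c) (at (coords c q)) \<circ> transition_deriv A c q))
      (at (coords ?e q))"
  proof (rule has_derivative_transform_within_open)
    show "open ?W"
      using assms chart_at by (intro open_coords_image open_Int open_chart_dom) auto
    show "coords ?e q \<in> ?W" using assms chart_at by auto
    show "((coords d \<circ> param c) \<circ> (coords c \<circ> param ?e)) x = (coords d \<circ> param ?e) x" if "x \<in> ?W" for x
      using that chart_at by (auto simp: param_coords assms)
  qed
  from has_derivative_unique[OF this transition_has_derivative[OF assms(2,4)]] show ?thesis
    by (metis comp_apply)
qed

lemma transition_deriv_chart_at: "transition_deriv A (chart_at A q) q v = v"
proof -
  let ?e = "chart_at A q"
  have "((coords ?e \<circ> param ?e) has_derivative (\<lambda>v. v)) (at (coords ?e q))"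
    by (rule has_derivative_transform_within_open[OF has_derivative_ident
          open_chart_image[OF chart_at(1)] coords_in[OF chart_at(2)]])
      (simp add: coords_param[OF chart_at(1)])
  from has_derivative_unique[OF this transition_has_derivative[OF chart_at]] show ?thesis
    by metis
qed

lemma linear_transition_deriv:
  "c \<in> A \<Longrightarrow> q \<in> chart_dom c \<Longrightarrow> linear (transition_deriv A c q)"
  using transition_has_derivative has_derivative_linear by blast

text \<open>The derivative of the transition back to the chart fixed at \<open>q\<close> is a left
  inverse.\<close>

lemma inj_transition_deriv:
  assumes "c \<in> A" "q \<in> chart_dom c"
  shows "inj (transition_deriv A c q)"
  by (rule injI) (metis assms chart_at transition_deriv_chain transition_deriv_chart_at)

lemma vf_in_chart_at: "vf_in_chart A (chart_at A q) X (coords (chart_at A q) q) = X q"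
  by (simp add: vf_in_chart_def param_coords chart_at transition_deriv_chart_at)

lemma vf_in_chart_change:
  assumes "c \<in> A" "d \<in> A" "x \<in> coords c ` (chart_dom c \<inter> chart_dom d)"
  shows "vf_in_chart A d X ((coords d \<circ> param c) x) =
    frechet_derivative (coords d \<circ> param c) (at x) (vf_in_chart A c X x)"
  using assms by (auto simp: vf_in_chart_def param_coords transition_deriv_chain[of c d])

lemma vf_in_chart_sum:
  assumes "c \<in> A" "x \<in> chart_image c"
  shows "vf_in_chart A c (\<lambda>q. \<Sum>i\<in>I. a i q *\<^sub>R X i q) x =
    (\<Sum>i\<in>I. (a i \<circ> param c) x *\<^sub>R vf_in_chart A c (X i) x)"
  unfolding vf_in_chart_def
  using linear_transition_deriv[OF assms(1) param_in[OF assms]]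
  by (simp add: linear_sum linear_scale)

lemma lie_bracket_eq:
  "lie_bracket A X Y q = coord_bracket (vf_in_chart A (chart_at A q) X)
     (vf_in_chart A (chart_at A q) Y) (coords (chart_at A q) q)"
  by (simp add: lie_bracket_def coord_bracket_def Let_def)

lemma vector_fieldD: "vector_field A X \<Longrightarrow> c \<in> A \<Longrightarrow> smooth_on (chart_image c) (vf_in_chart A c X)"
  by (simp add: vector_field_def)

text \<open>Any chart computes the same bracket, by naturality under the transition map. Thus near a
  point the bracket is represented in one chart throughout, although its definition uses a chart
  that varies with the point.\<close>

lemma vf_in_chart_lie_bracket:
  assumes X: "vector_field A X" and Y: "vector_field A Y" and c: "c \<in> A" "x \<in> chart_image c"
  shows "vf_in_chart A c (lie_bracket A X Y) x =
    coord_bracket (vf_in_chart A c X) (vf_in_chart A c Y) x"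
proof -
  define q where "q = param c x"
  let ?e = "chart_at A q"
  let ?U = "coords ?e ` (chart_dom ?e \<inter> chart_dom c)"
  have q: "q \<in> chart_dom c" "coords c q = x"
    using c by (simp_all add: q_def param_in coords_param)
  have \<phi>q: "(coords c \<circ> param ?e) (coords ?e q) = x"
    by (simp add: param_coords chart_at q)
  have sub: "?U \<subseteq> chart_image ?e" by (auto simp: chart_image_def)
  have "coord_bracket (vf_in_chart A c X) (vf_in_chart A c Y) ((coords c \<circ> param ?e) (coords ?e q)) =
      frechet_derivative (coords c \<circ> param ?e) (at (coords ?e q))
        (coord_bracket (vf_in_chart A ?e X) (vf_in_chart A ?e Y) (coords ?e q))"
  proof (rule coord_bracket_naturality[where U = ?U and V = "chart_image c"])
    show "(coords c \<circ> param ?e) ` ?U \<subseteq> chart_image c"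
      by (auto simp: param_coords chart_at coords_in)
    show "smooth_on ?U (vf_in_chart A ?e X)" "smooth_on ?U (vf_in_chart A ?e Y)"
      using vector_fieldD[OF _ chart_at(1)] X Y sub by (blast intro: smooth_on_subset)+
    show "open ?U" by (intro open_coords_image open_chart_dom chart_at c)
    show "coords ?e q \<in> ?U" using chart_at q by blast
  qed (assumption | rule c chart_at open_chart_image smooth_transition vector_fieldD[OF X]
      vector_fieldD[OF Y] vf_in_chart_change)+
  then show ?thesis
    unfolding \<phi>q vf_in_chart_def[of A c "lie_bracket A X Y"] q_def[symmetric] lie_bracket_eq
    by (simp add: transition_deriv_def)
qed

lemma vector_field_lie_bracket:
  assumes "vector_field A X" "vector_field A Y"
  shows "vector_field A (lie_bracket A X Y)"
  unfolding vector_field_def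
proof
  fix c assume c: "c \<in> A"
  show "smooth_on (chart_image c) (vf_in_chart A c (lie_bracket A X Y))"
    by (rule smooth_on_cong[THEN iffD2, OF open_chart_image[OF c] vf_in_chart_lie_bracket])
      (use assms c in \<open>auto intro!: smooth_on_coord_bracket open_chart_image vector_fieldD\<close>)
qed

lemma smooth_mapD: "smooth_map A a \<Longrightarrow> c \<in> A \<Longrightarrow> smooth_on (chart_image c) (a \<circ> param c)"
  by (simp add: smooth_map_def)

lemma smooth_map_const: "smooth_map A (\<lambda>q. c)"
  unfolding smooth_map_def comp_def by (simp add: smooth_on_const)

lemma vector_field_sum:
  assumes "\<And>i. i \<in> I \<Longrightarrow> smooth_map A (a i)" "\<And>i. i \<in> I \<Longrightarrow> vector_field A (X i)"
  shows "vector_field A (\<lambda>q. \<Sum>i\<in>I. a i q *\<^sub>R X i q)"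
  unfolding vector_field_def
proof
  fix c assume c: "c \<in> A"
  have "smooth_on (chart_image c) (\<lambda>x. \<Sum>i\<in>I. (a i \<circ> param c) x *\<^sub>R vf_in_chart A c (X i) x)"
    by (intro smooth_on_sum smooth_on_scaleR open_chart_image[OF c] vector_fieldD[OF _ c]
        smooth_mapD[OF _ c] assms)
  then show "smooth_on (chart_image c) (vf_in_chart A c (\<lambda>q. \<Sum>i\<in>I. a i q *\<^sub>R X i q))"
    by (subst smooth_on_cong[OF open_chart_image[OF c] vf_in_chart_sum[OF c]])
qed

text \<open>In each chart this is the Cramer argument; the representatives of the frame stay
  independent because the transition derivative is injective.\<close>

lemma smooth_map_frame_coefficients:
  fixes F :: "'k::finite \<Rightarrow> 'a \<Rightarrow> 'e"
  assumes F: "\<And>i. vector_field A (F i)"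
    and indep: "\<And>q c. (\<Sum>i\<in>UNIV. c i *\<^sub>R F i q) = 0 \<Longrightarrow> c = (\<lambda>i. 0)"
    and X: "vector_field A (\<lambda>q. \<Sum>i\<in>UNIV. a i q *\<^sub>R F i q)"
  shows "smooth_map A (a k)"
  unfolding smooth_map_def
proof
  fix c assume c: "c \<in> A"
  show "smooth_on (chart_image c) (a k \<circ> param c)"
  proof (rule smooth_on_frame_coefficients[where F = "\<lambda>i. vf_in_chart A c (F i)"
        and a = "\<lambda>i. a i \<circ> param c"])
    show "smooth_on (chart_image c) (\<lambda>x. \<Sum>i\<in>UNIV. (a i \<circ> param c) x *\<^sub>R vf_in_chart A c (F i) x)"
      by (rule smooth_on_cong[THEN iffD1, OF open_chart_image[OF c] vf_in_chart_sum[OF c]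
            vector_fieldD[OF X c]])
    fix x b assume x: "x \<in> chart_image c"
      and 0: "(\<Sum>i\<in>UNIV. b i *\<^sub>R vf_in_chart A c (F i) x) = 0"
    have lin: "linear (transition_deriv A c (param c x))"
      by (rule linear_transition_deriv[OF c param_in[OF c x]])
    have "transition_deriv A c (param c x) (\<Sum>i\<in>UNIV. b i *\<^sub>R F i (param c x)) = 0"
      using 0 by (simp add: vf_in_chart_def linear_sum[OF lin] linear_scale[OF lin])
    then have "(\<Sum>i\<in>UNIV. b i *\<^sub>R F i (param c x)) = 0"
      using lin inj_transition_deriv[OF c param_in[OF c x]] linear_injective_0 by blast
    then show "b = (\<lambda>i. 0)" by (rule indep)
  qed (use F c open_chart_image vector_fieldD in auto)
qed

text \<open>\<open>X q\<close> can be inserted without conversion, since it already consists of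
  components in the chart fixed at \<open>q\<close>.\<close>

definition lie_deriv :: "('a \<Rightarrow> 'e) \<Rightarrow> ('a \<Rightarrow> real) \<Rightarrow> 'a \<Rightarrow> real" where
  "lie_deriv X a q =
     frechet_derivative (a \<circ> param (chart_at A q)) (at (coords (chart_at A q) q)) (X q)"

lemma lie_bracket_commute: "lie_bracket A X Y q = - lie_bracket A Y X q"
  by (simp add: lie_bracket_eq coord_bracket_def)

lemma lie_bracket_self: "lie_bracket A X X q = 0"
  by (simp add: lie_bracket_eq coord_bracket_def)

text \<open>The Leibniz rule for a combination with function coefficients. Everything is evaluated
  at \<open>q\<close>, so the chart fixed there suffices.\<close>

lemma lie_bracket_sum_right:
  assumes a: "\<And>i. i \<in> I \<Longrightarrow> smooth_map A (a i)" and Y: "\<And>i. i \<in> I \<Longrightarrow> vector_field A (Y i)"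
    and X: "vector_field A X"
  shows "lie_bracket A X (\<lambda>q. \<Sum>i\<in>I. a i q *\<^sub>R Y i q) q =
    (\<Sum>i\<in>I. a i q *\<^sub>R lie_bracket A X (Y i) q + lie_deriv X (a i) q *\<^sub>R Y i q)"
proof -
  let ?e = "chart_at A q"
  let ?x = "coords ?e q"
  let ?X = "vf_in_chart A ?e X"
  let ?Y = "\<lambda>i. vf_in_chart A ?e (Y i)"
  let ?a = "\<lambda>i. a i \<circ> param ?e"
  have x: "?x \<in> chart_image ?e" by (rule coords_in[OF chart_at(2)])
  have param: "param ?e ?x = q" by (rule param_coords[OF chart_at])
  have lin: "linear (frechet_derivative ?X (at ?x))"
    by (rule smooth_on_imp_linear[OF vector_fieldD[OF X chart_at(1)] x])
  have "(vf_in_chart A ?e (\<lambda>q. \<Sum>i\<in>I. a i q *\<^sub>R Y i q) has_derivative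
     (\<lambda>v. \<Sum>i\<in>I. ?a i ?x *\<^sub>R frechet_derivative (?Y i) (at ?x) v +
        frechet_derivative (?a i) (at ?x) v *\<^sub>R ?Y i ?x)) (at ?x)"
  proof (rule has_derivative_transform_within_open[OF _ open_chart_image[OF chart_at(1)] x])
    show "((\<lambda>x. \<Sum>i\<in>I. ?a i x *\<^sub>R ?Y i x) has_derivative
     (\<lambda>v. \<Sum>i\<in>I. ?a i ?x *\<^sub>R frechet_derivative (?Y i) (at ?x) v +
        frechet_derivative (?a i) (at ?x) v *\<^sub>R ?Y i ?x)) (at ?x)"
    proof (rule has_derivative_sum)
      fix i assume "i \<in> I"
      show "((\<lambda>x. ?a i x *\<^sub>R ?Y i x) has_derivative
         (\<lambda>v. ?a i ?x *\<^sub>R frechet_derivative (?Y i) (at ?x) v +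
            frechet_derivative (?a i) (at ?x) v *\<^sub>R ?Y i ?x)) (at ?x)"
        by (rule has_derivative_scaleR[OF
              smooth_on_imp_has_derivative[OF smooth_mapD[OF a[OF \<open>i \<in> I\<close>] chart_at(1)] x]
              smooth_on_imp_has_derivative[OF vector_fieldD[OF Y[OF \<open>i \<in> I\<close>] chart_at(1)] x]])
    qed
  qed (simp add: vf_in_chart_sum[OF chart_at(1)])
  from frechet_derivative_at[OF this, symmetric] show ?thesis
    unfolding lie_bracket_eq coord_bracket_def vf_in_chart_at lie_deriv_def
    by (simp add: param linear_sum[OF lin] linear_scale[OF lin] scaleR_diff_right
        sum.distrib sum_subtractf)
qed

lemma lie_bracket_sum_left:
  assumes "\<And>i. i \<in> I \<Longrightarrow> smooth_map A (a i)" "\<And>i. i \<in> I \<Longrightarrow> vector_field A (Y i)"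
    "vector_field A X"
  shows "lie_bracket A (\<lambda>q. \<Sum>i\<in>I. a i q *\<^sub>R Y i q) X q =
    (\<Sum>i\<in>I. a i q *\<^sub>R lie_bracket A (Y i) X q - lie_deriv X (a i) q *\<^sub>R Y i q)"
  unfolding lie_bracket_commute[of _ X]
  using lie_bracket_sum_right[of I a Y X q, OF assms]
  by (simp add: sum_negf sum_subtractf sum.distrib)

end

section \<open>Distributions spanned by frames\<close>

text \<open>Stated for an indexed family, so that repeated members count as dependent and sums over
  the index type can be used directly.\<close>

definition indep_family :: "('k::finite \<Rightarrow> 'v::real_vector) \<Rightarrow> bool" where
  "indep_family F \<longleftrightarrow> (\<forall>c. (\<Sum>i\<in>UNIV. c i *\<^sub>R F i) = 0 \<longrightarrow> c = (\<lambda>i. 0))"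

lemma span_range_coefficients:
  fixes F :: "'k::finite \<Rightarrow> 'v::real_vector"
  assumes "x \<in> span (range F)"
  obtains c where "x = (\<Sum>i\<in>UNIV. c i *\<^sub>R F i)"
proof -
  have "span (range F) \<subseteq> range (\<lambda>c. \<Sum>i\<in>UNIV. c i *\<^sub>R F i)"
  proof (rule span_minimal)
    show "range F \<subseteq> range (\<lambda>c. \<Sum>i\<in>UNIV. c i *\<^sub>R F i)"
    proof
      fix y assume "y \<in> range F"
      then obtain j where "y = F j" by auto
      then have "y = (\<Sum>i\<in>UNIV. (if i = j then 1 else 0) *\<^sub>R F i)"
        by (simp add: if_distrib[of "\<lambda>r. r *\<^sub>R _"] cong: if_cong)
      then show "y \<in> range (\<lambda>c. \<Sum>i\<in>UNIV. c i *\<^sub>R F i)"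
        by (auto intro!: range_eqI[of _ _ "\<lambda>i. if i = j then 1 else 0"])
    qed
    show "subspace (range (\<lambda>c. \<Sum>i\<in>UNIV. c i *\<^sub>R F i))"
    proof (rule subspaceI)
      show "0 \<in> range (\<lambda>c. \<Sum>i\<in>UNIV. c i *\<^sub>R F i)"
        by (rule range_eqI[of _ _ "\<lambda>i. 0"]) simp
    next
      fix x y assume "x \<in> range (\<lambda>c. \<Sum>i\<in>UNIV. c i *\<^sub>R F i)" "y \<in> range (\<lambda>c. \<Sum>i\<in>UNIV. c i *\<^sub>R F i)"
      then obtain c d where "x = (\<Sum>i\<in>UNIV. c i *\<^sub>R F i)" "y = (\<Sum>i\<in>UNIV. d i *\<^sub>R F i)"
        by auto
      then have "x + y = (\<Sum>i\<in>UNIV. (c i + d i) *\<^sub>R F i)"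
        by (simp add: scaleR_add_left sum.distrib)
      then show "x + y \<in> range (\<lambda>c. \<Sum>i\<in>UNIV. c i *\<^sub>R F i)"
        by (auto intro!: range_eqI[of _ _ "\<lambda>i. c i + d i"])
    next
      fix r x assume "x \<in> range (\<lambda>c. \<Sum>i\<in>UNIV. c i *\<^sub>R F i)"
      then obtain c where "x = (\<Sum>i\<in>UNIV. c i *\<^sub>R F i)" by auto
      then have "r *\<^sub>R x = (\<Sum>i\<in>UNIV. (r * c i) *\<^sub>R F i)"
        by (simp add: scaleR_sum_right)
      then show "r *\<^sub>R x \<in> range (\<lambda>c. \<Sum>i\<in>UNIV. c i *\<^sub>R F i)"
        by (auto intro!: range_eqI[of _ _ "\<lambda>i. r * c i"])
    qed
  qed
  with assms that show thesis by auto
qed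

lemma dim_indep_family:
  fixes F :: "'k::finite \<Rightarrow> 'v::euclidean_space"
  assumes "indep_family F"
  shows "dim (span (range F)) = CARD('k)"
proof -
  have "inj F"
  proof (rule injI, rule ccontr)
    fix i j assume ij: "F i = F j" "i \<noteq> j"
    \<comment> \<open>If two members coincided, the coefficients 1 and -1 on them would form a
      nontrivial relation.\<close>
    let ?c = "\<lambda>k. if k = i then 1 else if k = j then - 1 else (0::real)"
    have "(\<Sum>k\<in>UNIV. ?c k *\<^sub>R F k) = (\<Sum>k\<in>{i,j}. ?c k *\<^sub>R F k)"
      by (rule sum.mono_neutral_right) auto
    also have "\<dots> = 0" using ij by simp
    finally have "?c = (\<lambda>k. 0)" using assms by (simp add: indep_family_def)
    then show False by (metis zero_neq_one)
  qed
  have "independent (range F)"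
  proof (rule independent_if_scalars_zero)
    fix f x assume 0: "(\<Sum>x\<in>range F. f x *\<^sub>R x) = 0" and x: "x \<in> range F"
    have "(\<Sum>i\<in>UNIV. f (F i) *\<^sub>R F i) = 0"
      using 0 by (simp add: sum.reindex[OF \<open>inj F\<close>])
    then have "(\<lambda>i. f (F i)) = (\<lambda>i. 0)"
      using assms by (simp add: indep_family_def)
    with x show "f x = 0" by (auto simp: fun_eq_iff)
  qed simp
  then have "dim (range F) = card (range F)"
    by (rule dim_eq_card_independent)
  then show ?thesis
    by (simp only: dim_span card_image[OF \<open>inj F\<close>])
qed

text \<open>Indexing triples by the numeral type \<open>3\<close> turns the statements about general
  finite frames into explicit formulas through \<open>sum_3\<close>. It is applied to vectors,
  fields and coefficient functions alike.\<close>

definition tri :: "'b \<Rightarrow> 'b \<Rightarrow> 'b \<Rightarrow> 3 \<Rightarrow> 'b" where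
  "tri x y z i = (if i = 1 then x else if i = 2 then y else z)"

lemma tri_simps [simp]: "tri x y z 1 = x" "tri x y z 2 = y" "tri x y z 3 = z"
  by (simp_all add: tri_def)

lemma tri_app: "tri f g h i q = tri (f q) (g q) (h q) i"
  by (simp add: tri_def)

lemma range_tri: "range (tri x y z) = {x, y, z}"
  by (simp add: UNIV_3)

definition duo :: "'b \<Rightarrow> 'b \<Rightarrow> 2 \<Rightarrow> 'b" where
  "duo x y i = (if i = 1 then x else y)"

lemma duo_simps [simp]: "duo x y 1 = x" "duo x y 2 = y"
  by (simp_all add: duo_def)

lemma duo_all: "P x \<Longrightarrow> P y \<Longrightarrow> P (duo x y i)"
  by (simp add: duo_def)

lemma duo_app: "duo f g i q = duo (f q) (g q) i"
  by (simp add: duo_def)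

lemma range_duo: "range (duo x y) = {x, y}"
  by (simp add: UNIV_2)

lemma indep_family_tri:
  "indep_family (tri x y z) \<longleftrightarrow> (\<forall>a b c. a *\<^sub>R x + b *\<^sub>R y + c *\<^sub>R z = 0 \<longrightarrow> a = 0 \<and> b = 0 \<and> c = 0)"
proof
  assume L: "indep_family (tri x y z)"
  show "\<forall>a b c. a *\<^sub>R x + b *\<^sub>R y + c *\<^sub>R z = 0 \<longrightarrow> a = 0 \<and> b = 0 \<and> c = 0"
  proof (intro allI impI)
    fix a b c assume "a *\<^sub>R x + b *\<^sub>R y + c *\<^sub>R z = 0"
    then have "tri a b c = (\<lambda>i. 0)"
      using L by (simp add: indep_family_def sum_3)
    then show "a = 0 \<and> b = 0 \<and> c = 0" by (metis tri_simps)
  qed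
next
  assume "\<forall>a b c. a *\<^sub>R x + b *\<^sub>R y + c *\<^sub>R z = 0 \<longrightarrow> a = 0 \<and> b = 0 \<and> c = 0"
  then show "indep_family (tri x y z)"
    by (simp add: indep_family_def sum_3 fun_eq_iff forall_3)
qed

lemma indep_family_duo:
  "indep_family (duo x y) \<longleftrightarrow> (\<forall>a b. a *\<^sub>R x + b *\<^sub>R y = 0 \<longrightarrow> a = 0 \<and> b = 0)"
proof
  assume L: "indep_family (duo x y)"
  show "\<forall>a b. a *\<^sub>R x + b *\<^sub>R y = 0 \<longrightarrow> a = 0 \<and> b = 0"
  proof (intro allI impI)
    fix a b assume "a *\<^sub>R x + b *\<^sub>R y = 0"
    then have "duo a b = (\<lambda>i. 0)"
      using L by (simp add: indep_family_def sum_2)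
    then show "a = 0 \<and> b = 0" by (metis duo_simps)
  qed
next
  assume "\<forall>a b. a *\<^sub>R x + b *\<^sub>R y = 0 \<longrightarrow> a = 0 \<and> b = 0"
  then show "indep_family (duo x y)"
    by (simp add: indep_family_def sum_2 fun_eq_iff forall_2)
qed

lemma indep_family_triI:
  assumes "distinct [x, y, z]" "independent {x, y, z}"
  shows "indep_family (tri x y z)"
  unfolding indep_family_tri
proof (intro allI impI)
  fix a b c assume 0: "a *\<^sub>R x + b *\<^sub>R y + c *\<^sub>R z = 0"
  define u where "u v = (if v = x then a else if v = y then b else c)" for v
  have "(\<Sum>v\<in>{x, y, z}. u v *\<^sub>R v) = 0"
    using assms(1) 0 by (auto simp: u_def add.assoc)
  then have "\<forall>v\<in>{x, y, z}. u v = 0"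
    using independentD[OF assms(2), of "{x, y, z}" u] by blast
  then show "a = 0 \<and> b = 0 \<and> c = 0"
    using assms(1) by (auto simp: u_def split: if_splits)
qed

section \<open>Framed distributions, their squares and the abnormal velocities\<close>

context manifold
begin

lemma section_coefficients:
  fixes F :: "'k::finite \<Rightarrow> 'a \<Rightarrow> 'e"
  assumes F: "\<And>i. vector_field A (F i)" and indep: "\<And>q. indep_family (\<lambda>i. F i q)"
    and X: "vector_field A X" "\<And>q. X q \<in> span (range (\<lambda>i. F i q))"
  obtains a where "\<And>i. smooth_map A (a i)" "X = (\<lambda>q. \<Sum>i\<in>UNIV. a i q *\<^sub>R F i q)"
proof -
  have "\<exists>c. X q = (\<Sum>i\<in>UNIV. c i *\<^sub>R F i q)" for q
    using span_range_coefficients[OF X(2)] by metis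
  then obtain c where c: "\<And>q. X q = (\<Sum>i\<in>UNIV. c q i *\<^sub>R F i q)" by metis
  then have X': "X = (\<lambda>q. \<Sum>i\<in>UNIV. (\<lambda>i q. c q i) i q *\<^sub>R F i q)" by auto
  have "smooth_map A ((\<lambda>i q. c q i) i)" for i
    by (rule smooth_map_frame_coefficients[OF F, where a = "\<lambda>i q. c q i"])
      (use indep X(1) X' in \<open>auto simp: indep_family_def\<close>)
  then show thesis using X' by (rule that)
qed

text \<open>Sections have smooth coefficients in the frame, so by the Leibniz rule every bracket of
  sections is a combination of brackets of frame fields plus derivative terms that lie in the
  distribution itself.\<close>

lemma dist_square_frame:
  fixes F :: "'k::finite \<Rightarrow> 'a \<Rightarrow> 'e"
  assumes F: "\<And>i. vector_field A (F i)" and indep: "\<And>q. indep_family (\<lambda>i. F i q)"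
  shows "dist_square A (\<lambda>q. span (range (\<lambda>i. F i q))) q =
    span (range (\<lambda>i. F i q) \<union> range (\<lambda>(i, j). lie_bracket A (F i) (F j) q))"
proof -
  let ?D = "\<lambda>q. span (range (\<lambda>i. F i q))"
  let ?B = "{lie_bracket A X Y q |X Y. is_section A ?D X \<and> is_section A ?D Y}"
  let ?R = "range (\<lambda>i. F i q)"
  let ?L = "range (\<lambda>(i, j). lie_bracket A (F i) (F j) q)"
  have FL: "F i q \<in> span (?R \<union> ?L)" "lie_bracket A (F i) (F j) q \<in> span (?R \<union> ?L)" for i j
    by (auto intro!: span_base)
  have "lie_bracket A X Y q \<in> span (?R \<union> ?L)"
    if XY: "is_section A ?D X" "is_section A ?D Y" for X Y
  proof -
    have X: "vector_field A X" using XY by (simp add: is_section_def)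
    obtain a where a: "\<And>i. smooth_map A (a i)" "X = (\<lambda>q. \<Sum>i\<in>UNIV. a i q *\<^sub>R F i q)"
      using section_coefficients[OF F indep, of X] XY by (auto simp: is_section_def)
    obtain b where b: "\<And>i. smooth_map A (b i)" "Y = (\<lambda>q. \<Sum>i\<in>UNIV. b i q *\<^sub>R F i q)"
      using section_coefficients[OF F indep, of Y] XY by (auto simp: is_section_def)
    have "lie_bracket A X (F j) q \<in> span (?R \<union> ?L)" for j
      unfolding a(2) lie_bracket_sum_left[where I = UNIV and a = a and Y = F, OF a(1) F F]
      by (intro span_sum span_diff span_scale FL)
    then show ?thesis
      unfolding b(2) lie_bracket_sum_right[where I = UNIV and a = b and Y = F, OF b(1) F X]
      by (intro span_sum span_add span_scale FL)
  qed
  then have B: "?B \<subseteq> span (?R \<union> ?L)" by blast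
  have "is_section A ?D (F i)" for i
    using F by (auto simp: is_section_def intro: span_base)
  then have L: "?L \<subseteq> ?B" by fastforce
  have "dist_square A ?D q = span (?R \<union> ?B)"
    unfolding dist_square_def set_plus_pt_def bracket_dist_def span_Un by blast
  also have "\<dots> = span (?R \<union> ?L)"
  proof (intro span_eq[THEN iffD2] conjI)
    show "?R \<union> ?B \<subseteq> span (?R \<union> ?L)"
      using B FL(1) by blast
    show "?R \<union> ?L \<subseteq> span (?R \<union> ?B)"
      using L span_superset[of "?R \<union> ?B"] by blast
  qed
  finally show ?thesis .
qed

text \<open>The derivative terms of the Leibniz rule are multiples of frame vectors and are killed
  by \<open>p\<close>; what remains depends only on the coefficients at \<open>q\<close>.\<close>

lemma inner_lie_bracket_frame:
  fixes F :: "'k::finite \<Rightarrow> 'a \<Rightarrow> 'e"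
  assumes F: "\<And>i. vector_field A (F i)" and a: "\<And>i. smooth_map A (a i)" and b: "\<And>i. smooth_map A (b i)"
    and p: "\<And>i. p \<bullet> F i q = 0"
    and X: "X = (\<lambda>q. \<Sum>i\<in>UNIV. a i q *\<^sub>R F i q)" and Y: "Y = (\<lambda>q. \<Sum>i\<in>UNIV. b i q *\<^sub>R F i q)"
  shows "p \<bullet> lie_bracket A X Y q =
    (\<Sum>j\<in>UNIV. \<Sum>i\<in>UNIV. a i q * b j q * (p \<bullet> lie_bracket A (F i) (F j) q))"
proof -
  have "vector_field A X" unfolding X by (intro vector_field_sum a F)
  then have "p \<bullet> lie_bracket A X Y q = (\<Sum>j\<in>UNIV. b j q * (p \<bullet> lie_bracket A X (F j) q))"
    unfolding Y using lie_bracket_sum_right[where I = UNIV and a = b and Y = F and X = X] b F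
    by (simp add: inner_sum_right inner_add_right p)
  moreover have "p \<bullet> lie_bracket A X (F j) q = (\<Sum>i\<in>UNIV. a i q * (p \<bullet> lie_bracket A (F i) (F j) q))" for j
    unfolding X using lie_bracket_sum_left[where I = UNIV and a = a and Y = F and X = "F j"] a F
    by (simp add: inner_sum_right inner_diff_right p)
  ultimately show ?thesis
    by (simp add: sum_distrib_left mult_ac)
qed

lemma lie_deriv_const: "lie_deriv X (\<lambda>q. c) q = 0"
  by (simp add: lie_deriv_def comp_def)

lemma lie_bracket_scale_diff_right:
  assumes "vector_field A X" "vector_field A Y" "vector_field A Z" "smooth_map A a"
  shows "lie_bracket A X (\<lambda>q. a q *\<^sub>R Y q - Z q) q =
    a q *\<^sub>R lie_bracket A X Y q + lie_deriv X a q *\<^sub>R Y q - lie_bracket A X Z q"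
  \<comment> \<open>The subtracted field carries the constant coefficient -1, whose Lie derivative
    vanishes.\<close>
  using lie_bracket_sum_right[where I = UNIV and a = "duo a (\<lambda>_. - 1)" and Y = "duo Y Z" and X = X and q = q]
    assms by (simp add: smooth_map_const lie_deriv_const sum_2 duo_all[of "smooth_map A"] duo_all[of "vector_field A"])

lemma vector_field_scale_diff:
  assumes "vector_field A Y" "vector_field A Z" "smooth_map A a"
  shows "vector_field A (\<lambda>q. a q *\<^sub>R Y q - Z q)"
  using vector_field_sum[where I = UNIV and a = "duo a (\<lambda>_. - 1)" and X = "duo Y Z"]
    assms by (simp add: smooth_map_const sum_2 duo_all[of "smooth_map A"] duo_all[of "vector_field A"])

text \<open>In canonical coordinates the Hamiltonian is linear in the covector, so its derivative
  along the fibre returns the field.\<close>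

lemma proj_deriv_ham_vf:
  assumes "vector_field A f"
  shows "proj_deriv (ham_vf A (ham f) (q, p)) = f q"
proof -
  let ?c = "chart_at A q"
  let ?f = "vf_in_chart A ?c f"
  let ?x = "coords ?c q"
  note c = chart_at(1)[of q]
  have x: "?x \<in> chart_image ?c" by (rule coords_in[OF chart_at(2)])
  have eq: "cot_in_chart A ?c (ham f) z = snd z \<bullet> ?f (fst z)" if "z \<in> chart_image ?c \<times> UNIV" for z
  proof -
    from that have z: "fst z \<in> chart_image ?c" by auto
    \<comment> \<open>The adjoint in \<open>cot_in_chart\<close> moves from the covector to the
      field and turns \<open>f\<close> into its coordinate representation.\<close>
    show ?thesis
      using adjoint_works[OF linear_transition_deriv[OF c param_in[OF c z]],
          of "f (param ?c (fst z))" "snd z"]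
      by (simp add: cot_in_chart_def ham_def vf_in_chart_def case_prod_beta inner_commute)
  qed
  have d1: "((\<lambda>z. ?f (fst z)) has_derivative (\<lambda>h. frechet_derivative ?f (at ?x) (fst h))) (at (?x, p))"
    by (rule has_derivative_compose[where f = fst and g = ?f])
      (auto intro!: derivative_eq_intros smooth_on_imp_has_derivative[OF vector_fieldD[OF assms c] x])
  have "((\<lambda>z. snd z \<bullet> ?f (fst z)) has_derivative
      (\<lambda>h. p \<bullet> frechet_derivative ?f (at ?x) (fst h) + snd h \<bullet> ?f ?x)) (at (?x, p))"
    using has_derivative_inner[OF has_derivative_snd[OF has_derivative_ident] d1] by simp
  then have "(cot_in_chart A ?c (ham f) has_derivative
      (\<lambda>h. p \<bullet> frechet_derivative ?f (at ?x) (fst h) + snd h \<bullet> ?f ?x)) (at (?x, p))"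
    by (rule has_derivative_transform_within_open[of _ _ _ _ "chart_image ?c \<times> UNIV"])
      (use x eq open_chart_image[OF c] in \<open>auto intro: open_Times\<close>)
  from frechet_derivative_at[OF this, symmetric]
  have "proj_deriv (ham_vf A (ham f) (q, p)) = (\<Sum>b\<in>Basis. (b \<bullet> f q) *\<^sub>R b)"
    using linear_0[OF smooth_on_imp_linear[OF vector_fieldD[OF assms c] x]]
    by (simp add: proj_deriv_def ham_vf_def Let_def vf_in_chart_at)
  then show ?thesis by (simp add: inner_commute[of _ "f q"] euclidean_representation)
qed

definition frame :: "('a \<Rightarrow> 'e) \<Rightarrow> ('a \<Rightarrow> 'e) \<Rightarrow> ('a \<Rightarrow> 'e) \<Rightarrow> bool" where
  "frame f0 f1 f2 \<longleftrightarrow> vector_field A f0 \<and> vector_field A f1 \<and> vector_field A f2 \<and>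
     (\<forall>q. indep_family (tri (f0 q) (f1 q) (f2 q)))"

lemma frame_control_system2: "control_system2 A f0 f1 f2 \<Longrightarrow> frame f0 f1 f2"
  by (auto simp: control_system2_def frame_def intro!: indep_family_triI)

lemma frameD:
  assumes "frame f0 f1 f2"
  shows "vector_field A f0" "vector_field A f1" "vector_field A f2"
    "vector_field A (tri f0 f1 f2 i)" "indep_family (tri (f0 q) (f1 q) (f2 q))"
    "vector_field A (duo f1 f2 j)" "indep_family (duo (f1 q) (f2 q))"
    "indep_family (\<lambda>i. tri f0 f1 f2 i q)" "indep_family (\<lambda>j. duo f1 f2 j q)"
proof -
  show 1: "vector_field A f0" "vector_field A f1" "vector_field A f2"
    and 2: "indep_family (tri (f0 q) (f1 q) (f2 q))"
    using assms by (auto simp: frame_def)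
  show "vector_field A (tri f0 f1 f2 i)" "vector_field A (duo f1 f2 j)"
    using 1 by (auto simp: tri_def duo_def)
  show 3: "indep_family (duo (f1 q) (f2 q))"
    using 2 unfolding indep_family_tri indep_family_duo
    by (metis add.left_neutral scaleR_zero_left)
  show "indep_family (\<lambda>i. tri f0 f1 f2 i q)" "indep_family (\<lambda>j. duo f1 f2 j q)"
    using 2 3 by (simp_all add: tri_app duo_app)
qed

lemma D3_eq: "D3 f0 f1 f2 = (\<lambda>q. span (range (\<lambda>i. tri f0 f1 f2 i q)))"
  by (auto simp: D3_def tri_app range_tri)

lemma D2_eq: "D2 f1 f2 = (\<lambda>q. span (range (\<lambda>i. duo f1 f2 i q)))"
  by (auto simp: D2_def duo_app range_duo)

text \<open>The brackets of a two-element frame are 0 and plus or minus a single bracket.\<close>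

lemma dist_square_D2:
  assumes "frame f0 f1 f2"
  shows "dist_square A (D2 f1 f2) q = span {f1 q, f2 q, lie_bracket A f1 f2 q}"
proof -
  have "dist_square A (D2 f1 f2) q =
      span ({f1 q, f2 q} \<union> {0, lie_bracket A f1 f2 q, - lie_bracket A f1 f2 q})"
    unfolding D2_eq dist_square_frame[OF frameD(6)[OF assms] frameD(9)[OF assms]]
    by (simp add: UNIV_2 UNIV_Times_UNIV[symmetric] lie_bracket_self lie_bracket_commute[of f2 f1]
        insert_commute del: UNIV_Times_UNIV)
  also have "\<dots> = span {f1 q, f2 q, lie_bracket A f1 f2 q}"
    by (rule span_eq[THEN iffD2]) (auto intro: span_base span_neg span_zero)
  finally show ?thesis .
qed

text \<open>Used for a lower bound on the dimension; the ambient dimension supplies the upper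
  one.\<close>

lemma dist_square_D3_supset:
  assumes "frame f0 f1 f2"
  shows "{f0 q, f1 q, f2 q, lie_bracket A f1 f2 q, lie_bracket A f0 f2 q} \<subseteq> dist_square A (D3 f0 f1 f2) q"
proof -
  have "tri f0 f1 f2 i q \<in> dist_square A (D3 f0 f1 f2) q"
    "lie_bracket A (tri f0 f1 f2 i) (tri f0 f1 f2 j) q \<in> dist_square A (D3 f0 f1 f2) q" for i j
    unfolding D3_eq dist_square_frame[OF frameD(4)[OF assms] frameD(8)[OF assms]]
    by (auto intro!: span_base)
  from this(1)[of 1] this(1)[of 2] this(1)[of 3] this(2)[of 2 3] this(2)[of 1 3]
  show ?thesis by simp
qed

text \<open>For p annihilating D3 with nonzero denominator, the two quotients are the unique
  coefficients for which \<open>v = f0 + c1 f1 + c2 f2\<close> satisfies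
  \<open>p \<bullet> [v, f1] = p \<bullet> [v, f2] = 0\<close>, the brackets being read through the
  tensorial form of \<open>p\<close>.\<close>

definition abn_velocity :: "('a \<Rightarrow> 'e) \<Rightarrow> ('a \<Rightarrow> 'e) \<Rightarrow> ('a \<Rightarrow> 'e) \<Rightarrow> 'a \<Rightarrow> 'e \<Rightarrow> 'e" where
  "abn_velocity f0 f1 f2 q p = f0 q
     + (p \<bullet> lie_bracket A f0 f2 q / (p \<bullet> lie_bracket A f2 f1 q)) *\<^sub>R f1 q
     + (p \<bullet> lie_bracket A f1 f0 q / (p \<bullet> lie_bracket A f2 f1 q)) *\<^sub>R f2 q"

definition abn_covector :: "('a \<Rightarrow> 'e) \<Rightarrow> ('a \<Rightarrow> 'e) \<Rightarrow> ('a \<Rightarrow> 'e) \<Rightarrow> 'a \<Rightarrow> 'e \<Rightarrow> bool" where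
  "abn_covector f0 f1 f2 q p \<longleftrightarrow>
     p \<bullet> f0 q = 0 \<and> p \<bullet> f1 q = 0 \<and> p \<bullet> f2 q = 0 \<and> p \<bullet> lie_bracket A f1 f2 q \<noteq> 0"

lemma annihilates_span: "(\<forall>v\<in>span S. p \<bullet> v = 0) \<longleftrightarrow> (\<forall>v\<in>S. p \<bullet> v = 0)"
proof
  assume "\<forall>v\<in>S. p \<bullet> v = 0"
  then have "span S \<subseteq> {v. p \<bullet> v = 0}"
    by (intro span_minimal subspace_hyperplane) auto
  then show "\<forall>v\<in>span S. p \<bullet> v = 0" by blast
qed (auto intro: span_base)

text \<open>Annihilating a span means annihilating its generators. A covector that kills
  \<open>f1\<close> and \<open>f2\<close> lies outside the annihilator of the square exactly when it
  is nonzero on their bracket, which is also the condition on the denominator.\<close>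

lemma Abn_eq:
  assumes "frame f0 f1 f2"
  shows "Abn A f0 f1 f2 q = abn_velocity f0 f1 f2 q ` {p. abn_covector f0 f1 f2 q p}"
proof -
  have "proj_deriv (abn_field A f0 f1 f2 (q, p)) = abn_velocity f0 f1 f2 q p" for p
    using proj_deriv_ham_vf[of f0 q p] proj_deriv_ham_vf[of f1 q p] proj_deriv_ham_vf[of f2 q p]
      frameD(1-3)[OF assms]
    by (simp add: abn_field_def abn_velocity_def proj_deriv_def ham_bracket_def)
  moreover have "(q, p) \<in> annihilator (D3 f0 f1 f2) - annihilator (dist_square A (D2 f1 f2)) \<longleftrightarrow>
      abn_covector f0 f1 f2 q p" for p
    by (auto simp: annihilator_def D3_def dist_square_D2[OF assms] annihilates_span abn_covector_def)
  ultimately show ?thesis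
    unfolding Abn_def by auto
qed

end

lemma smooth_on_componentwise:
  fixes f :: "'a::euclidean_space \<Rightarrow> 'b::euclidean_space"
  assumes "open S"
  shows "smooth_on S f \<longleftrightarrow> (\<forall>b\<in>Basis. smooth_on S (\<lambda>x. f x \<bullet> b))"
proof
  assume "smooth_on S f"
  then show "\<forall>b\<in>Basis. smooth_on S (\<lambda>x. f x \<bullet> b)"
    using assms by (simp add: smooth_on_inner smooth_on_const)
next
  assume "\<forall>b\<in>Basis. smooth_on S (\<lambda>x. f x \<bullet> b)"
  then have "smooth_on S (\<lambda>x. \<Sum>b\<in>Basis. (f x \<bullet> b) *\<^sub>R b)"
    using assms by (intro smooth_on_sum smooth_on_scaleR smooth_on_const) auto
  then show "smooth_on S f" by (simp add: euclidean_representation)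
qed

lemma ball_Basis_vec: "(\<forall>b\<in>(Basis :: (real^'n) set). P b) \<longleftrightarrow> (\<forall>i. P (axis i 1))"
  by (auto simp: Basis_vec_def)

lemma ball_Basis_matrix:
  "(\<forall>b\<in>(Basis :: (real^'n^'m) set). P b) \<longleftrightarrow> (\<forall>i j. P (axis i (axis j 1)))"
  by (auto simp: Basis_vec_def)

section \<open>Invariance of the abnormal velocities under feedback\<close>

context manifold
begin

lemma smooth_map_vec:
  fixes f :: "'a \<Rightarrow> real^'n"
  shows "smooth_map A f \<longleftrightarrow> (\<forall>i. smooth_map A (\<lambda>q. f q $ i))"
proof -
  have "smooth_on (chart_image c) (f \<circ> param c) \<longleftrightarrow>
      (\<forall>i. smooth_on (chart_image c) ((\<lambda>q. f q $ i) \<circ> param c))" if "c \<in> A" for c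
    unfolding smooth_on_componentwise[OF open_chart_image[OF that], of "f \<circ> param c"] ball_Basis_vec
    by (simp add: inner_axis comp_def)
  then show ?thesis unfolding smooth_map_def by blast
qed

lemma smooth_map_matrix:
  fixes f :: "'a \<Rightarrow> real^'n^'m"
  shows "smooth_map A f \<longleftrightarrow> (\<forall>i j. smooth_map A (\<lambda>q. f q $ i $ j))"
proof -
  have "smooth_on (chart_image c) (f \<circ> param c) \<longleftrightarrow>
      (\<forall>i j. smooth_on (chart_image c) ((\<lambda>q. f q $ i $ j) \<circ> param c))" if "c \<in> A" for c
    unfolding smooth_on_componentwise[OF open_chart_image[OF that], of "f \<circ> param c"] ball_Basis_matrix
    by (simp add: inner_axis comp_def)
  then show ?thesis unfolding smooth_map_def by blast
qed

text \<open>Coefficient functions found point by point become smooth as soon as the field they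
  compose is smooth. This provides the regularity of the feedback and of \<alpha> in the
  converse.\<close>

lemma smooth_map_triple_coefficients:
  assumes f: "frame f0 f1 f2"
    and X: "vector_field A X" "\<And>q. X q = a q *\<^sub>R f0 q + b q *\<^sub>R f1 q + c q *\<^sub>R f2 q"
  shows "smooth_map A a" "smooth_map A b" "smooth_map A c"
proof -
  have "vector_field A (\<lambda>q. \<Sum>i\<in>UNIV. tri a b c i q *\<^sub>R tri f0 f1 f2 i q)"
    using X by (simp add: sum_3 X(2)[abs_def, symmetric])
  then have "smooth_map A (tri a b c i)" for i
    using smooth_map_frame_coefficients[where F = "tri f0 f1 f2" and a = "tri a b c"]
      frameD(4,8)[OF f] by (auto simp: indep_family_def)
  from this[of 1] this[of 2] this[of 3]
  show "smooth_map A a" "smooth_map A b" "smooth_map A c" by simp_all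
qed

text \<open>An alternating form on a three-dimensional space, evaluated on two vectors, is the
  combination of its basis values with the 2x2 minors of their coordinates.\<close>

lemma inner_lie_bracket_triple:
  assumes f: "frame f0 f1 f2"
    and X: "vector_field A X" "\<And>q. X q = a0 q *\<^sub>R f0 q + a1 q *\<^sub>R f1 q + a2 q *\<^sub>R f2 q"
    and Y: "vector_field A Y" "\<And>q. Y q = b0 q *\<^sub>R f0 q + b1 q *\<^sub>R f1 q + b2 q *\<^sub>R f2 q"
    and p: "p \<bullet> f0 q = 0" "p \<bullet> f1 q = 0" "p \<bullet> f2 q = 0"
  shows "p \<bullet> lie_bracket A X Y q =
    (a0 q * b1 q - a1 q * b0 q) * (p \<bullet> lie_bracket A f0 f1 q) +
    (a0 q * b2 q - a2 q * b0 q) * (p \<bullet> lie_bracket A f0 f2 q) +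
    (a1 q * b2 q - a2 q * b1 q) * (p \<bullet> lie_bracket A f1 f2 q)"
proof -
  have "smooth_map A (tri a0 a1 a2 i)" "smooth_map A (tri b0 b1 b2 i)" "p \<bullet> tri f0 f1 f2 i q = 0" for i
    using smooth_map_triple_coefficients[OF f X] smooth_map_triple_coefficients[OF f Y] p
    by (simp_all add: tri_def)
  moreover have "X = (\<lambda>q. \<Sum>i\<in>UNIV. tri a0 a1 a2 i q *\<^sub>R tri f0 f1 f2 i q)"
    "Y = (\<lambda>q. \<Sum>i\<in>UNIV. tri b0 b1 b2 i q *\<^sub>R tri f0 f1 f2 i q)"
    using X(2) Y(2) by (auto simp: sum_3)
  ultimately have "p \<bullet> lie_bracket A X Y q = (\<Sum>j\<in>UNIV. \<Sum>i\<in>UNIV. tri a0 a1 a2 i q *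
      tri b0 b1 b2 j q * (p \<bullet> lie_bracket A (tri f0 f1 f2 i) (tri f0 f1 f2 j) q))"
    by (intro inner_lie_bracket_frame frameD(4)[OF f])
  then show ?thesis
    by (simp add: sum_3 lie_bracket_self lie_bracket_commute[of f1 f0] lie_bracket_commute[of f2 f0]
        lie_bracket_commute[of f2 f1] algebra_simps)
qed

text \<open>Here \<open>w01\<close>, \<open>w02\<close>, \<open>w12\<close> stand for the values of
  \<open>p\<close> on the brackets of the old fields, and the equations for the capital letters are
  their transformation law under the feedback. The claim is compared coefficient by coefficient in
  \<open>v1\<close> and \<open>v2\<close>.\<close>

lemma abn_velocity_invariant_algebra:
  fixes v0 v1 v2 :: "'v::real_vector" and a1 a2 w01 w02 w12 :: real
  assumes d: "b11 * b22 - b12 * b21 \<noteq> 0" and w: "w12 \<noteq> 0"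
    and W12_def: "W12 = (b11 * b22 - b12 * b21) * w12"
    and W01_def: "W01 = b11 * w01 + b21 * w02 + (a1 * b21 - a2 * b11) * w12"
    and W02_def: "W02 = b12 * w01 + b22 * w02 + (a1 * b22 - a2 * b12) * w12"
  shows "(v0 + a1 *\<^sub>R v1 + a2 *\<^sub>R v2) + (W02 / - W12) *\<^sub>R (b11 *\<^sub>R v1 + b21 *\<^sub>R v2) +
      (- W01 / - W12) *\<^sub>R (b12 *\<^sub>R v1 + b22 *\<^sub>R v2) =
    v0 + (w02 / - w12) *\<^sub>R v1 + (- w01 / - w12) *\<^sub>R v2"
proof -
  have W: "W12 \<noteq> 0" using d w by (simp add: W12_def)
  \<comment> \<open>With denominators cleared, both coefficient equations are polynomial
    identities.\<close>
  have "(a1 * W12 - W02 * b11 + W01 * b12) * w12 = - w02 * W12"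
    "(a2 * W12 - W02 * b21 + W01 * b22) * w12 = w01 * W12"
    unfolding W12_def W01_def W02_def by algebra+
  then have "a1 + (W02 / - W12) * b11 + (- W01 / - W12) * b12 = w02 / - w12"
    "a2 + (W02 / - W12) * b21 + (- W01 / - W12) * b22 = - w01 / - w12"
    using W w by (simp_all add: field_simps)
  moreover have "(v0 + a1 *\<^sub>R v1 + a2 *\<^sub>R v2) + (W02 / - W12) *\<^sub>R (b11 *\<^sub>R v1 + b21 *\<^sub>R v2) +
      (- W01 / - W12) *\<^sub>R (b12 *\<^sub>R v1 + b22 *\<^sub>R v2) =
    v0 + (a1 + (W02 / - W12) * b11 + (- W01 / - W12) * b12) *\<^sub>R v1 +
      (a2 + (W02 / - W12) * b21 + (- W01 / - W12) * b22) *\<^sub>R v2"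
    by (simp add: algebra_simps)
  ultimately show ?thesis by simp
qed

text \<open>A zero determinant would give \<open>b12 g1 - b11 g2 = 0\<close> and
  \<open>b22 g1 - b21 g2 = 0\<close>; independence then forces \<open>b11 = b21 = 0\<close>, that is
  \<open>g1 = 0\<close>.\<close>

lemma feedback_det:
  assumes g: "indep_family (duo g1 g2)"
    and g1: "g1 = b11 *\<^sub>R f1 + b21 *\<^sub>R f2" and g2: "g2 = b12 *\<^sub>R f1 + b22 *\<^sub>R f2"
  shows "b11 * b22 - b12 * b21 \<noteq> (0::real)"
proof
  assume d: "b11 * b22 - b12 * b21 = 0"
  have "b12 *\<^sub>R g1 + (- b11) *\<^sub>R g2 = (b12 * b21 - b11 * b22) *\<^sub>R f2"
    "b22 *\<^sub>R g1 + (- b21) *\<^sub>R g2 = (b11 * b22 - b12 * b21) *\<^sub>R f1"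
    unfolding g1 g2 by (simp_all add: algebra_simps)
  moreover have "b12 * b21 - b11 * b22 = 0" using d by simp
  ultimately have "b11 = 0" "b21 = 0"
    using g d unfolding indep_family_duo by (metis neg_equal_0_iff_equal scaleR_zero_left)+
  then have "1 *\<^sub>R g1 + 0 *\<^sub>R g2 = 0" by (simp add: g1)
  then show False using g unfolding indep_family_duo by fastforce
qed

text \<open>The admissible covectors coincide because the bracket of the input fields is multiplied
  by the determinant of the feedback matrix, modulo what \<open>p\<close> kills. Then the velocities
  agree covector by covector.\<close>

lemma Abn_feedback:
  assumes f: "frame f0 f1 f2" and g: "frame g0 g1 g2"
    and g0: "\<And>q. g0 q = f0 q + a1 q *\<^sub>R f1 q + a2 q *\<^sub>R f2 q"
    and g1: "\<And>q. g1 q = b11 q *\<^sub>R f1 q + b21 q *\<^sub>R f2 q"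
    and g2: "\<And>q. g2 q = b12 q *\<^sub>R f1 q + b22 q *\<^sub>R f2 q"
    and D3: "D3 g0 g1 g2 q = D3 f0 f1 f2 q"
  shows "Abn A f0 f1 f2 q = Abn A g0 g1 g2 q"
proof -
  note vg = frameD(1-3)[OF g]
  have g0': "g0 q = 1 *\<^sub>R f0 q + a1 q *\<^sub>R f1 q + a2 q *\<^sub>R f2 q"
    and g1': "g1 q = 0 *\<^sub>R f0 q + b11 q *\<^sub>R f1 q + b21 q *\<^sub>R f2 q"
    and g2': "g2 q = 0 *\<^sub>R f0 q + b12 q *\<^sub>R f1 q + b22 q *\<^sub>R f2 q" for q
    by (simp_all add: g0 g1 g2)
  have det: "b11 q * b22 q - b12 q * b21 q \<noteq> 0"
    by (rule feedback_det[OF frameD(7)[OF g] g1 g2])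
  have annih: "p \<bullet> f0 q = 0 \<and> p \<bullet> f1 q = 0 \<and> p \<bullet> f2 q = 0 \<longleftrightarrow>
      p \<bullet> g0 q = 0 \<and> p \<bullet> g1 q = 0 \<and> p \<bullet> g2 q = 0" for p
    using annihilates_span[of "{f0 q, f1 q, f2 q}" p] annihilates_span[of "{g0 q, g1 q, g2 q}" p] D3
    by (simp add: D3_def)
  have br: "p \<bullet> lie_bracket A g1 g2 q = (b11 q * b22 q - b12 q * b21 q) * (p \<bullet> lie_bracket A f1 f2 q)"
    "p \<bullet> lie_bracket A g0 g1 q = b11 q * (p \<bullet> lie_bracket A f0 f1 q) +
      b21 q * (p \<bullet> lie_bracket A f0 f2 q) + (a1 q * b21 q - a2 q * b11 q) * (p \<bullet> lie_bracket A f1 f2 q)"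
    "p \<bullet> lie_bracket A g0 g2 q = b12 q * (p \<bullet> lie_bracket A f0 f1 q) +
      b22 q * (p \<bullet> lie_bracket A f0 f2 q) + (a1 q * b22 q - a2 q * b12 q) * (p \<bullet> lie_bracket A f1 f2 q)"
    if "p \<bullet> f0 q = 0" "p \<bullet> f1 q = 0" "p \<bullet> f2 q = 0" for p
    using inner_lie_bracket_triple[OF f vg(2) g1' vg(3) g2' that]
      inner_lie_bracket_triple[OF f vg(1) g0' vg(2) g1' that]
      inner_lie_bracket_triple[OF f vg(1) g0' vg(3) g2' that] by simp_all
  have cov: "abn_covector f0 f1 f2 q p \<longleftrightarrow> abn_covector g0 g1 g2 q p" for p
    using annih[of p] br(1)[of p] det unfolding abn_covector_def by auto
  moreover have "abn_velocity f0 f1 f2 q p = abn_velocity g0 g1 g2 q p"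
    if p: "abn_covector f0 f1 f2 q p" for p
  proof -
    have p0: "p \<bullet> f0 q = 0" "p \<bullet> f1 q = 0" "p \<bullet> f2 q = 0" and w: "p \<bullet> lie_bracket A f1 f2 q \<noteq> 0"
      using p by (simp_all add: abn_covector_def)
    show ?thesis
      unfolding abn_velocity_def lie_bracket_commute[of f1 f0] lie_bracket_commute[of f2 f1]
        lie_bracket_commute[of g1 g0] lie_bracket_commute[of g2 g1] inner_minus_right br[OF p0] g0 g1 g2
      by (rule abn_velocity_invariant_algebra[OF det w refl refl refl, symmetric])
  qed
  ultimately show ?thesis
    unfolding Abn_eq[OF f] Abn_eq[OF g] by (intro image_cong) auto
qed

end

lemma indep_family_span_eq:
  fixes F G :: "'k::finite \<Rightarrow> 'v::euclidean_space"
  assumes "indep_family F" "indep_family G" "range G \<subseteq> span (range F)"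
  shows "span (range G) = span (range F)"
proof (rule subspace_dim_equal)
  show "span (range G) \<subseteq> span (range F)"
    by (rule span_minimal[OF assms(3) subspace_span])
qed (simp_all only: subspace_span dim_indep_family[OF assms(1)] dim_indep_family[OF assms(2)] order_refl)

text \<open>From dim \<le> card \<le> length, equality of the outer terms forces equality
  throughout. This extracts independence from a hypothesis on the dimension of a span.\<close>

lemma full_dim_span_list:
  fixes xs :: "'v::euclidean_space list"
  assumes "dim (span (set xs)) = length xs"
  shows "distinct xs" "independent (set xs)"
proof -
  have d: "dim (set xs) = length xs" using assms by simp
  have "dim (set xs) \<le> card (set xs)" by (rule dim_le_card') simp
  with d have card: "card (set xs) = length xs"
    using card_length[of xs] by simp
  then show "distinct xs" by (rule card_distinct)
  show "independent (set xs)"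
    by (rule card_le_dim_spanning[of _ "set xs"]) (use d card in \<open>auto intro: span_superset[THEN subsetD]\<close>)
qed

lemma indep_family_tri_of_independent:
  assumes "distinct [x, y, z, v, w]" "independent {x, y, z, v, w}"
  shows "indep_family (tri x y z)"
proof (rule indep_family_triI)
  show "independent {x, y, z}"
    by (rule independent_mono[OF assms(2)]) auto
qed (use assms(1) in simp)

context manifold
begin

text \<open>Both sides of the feedback identity are affine in the control, so comparing them at 0
  and at the two unit vectors reads off the shift and the columns of the matrix.\<close>

lemma feedback_equivalent_iff:
  "feedback_equivalent A f0 f1 f2 g0 g1 g2 \<longleftrightarrow>
    (\<exists>a1 a2 b11 b12 b21 b22. smooth_map A a1 \<and> smooth_map A a2 \<and> smooth_map A b11 \<and>
      smooth_map A b12 \<and> smooth_map A b21 \<and> smooth_map A b22 \<and>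
      (\<forall>q. b11 q * b22 q - b12 q * b21 q \<noteq> 0) \<and>
      (\<forall>q. g0 q = f0 q + a1 q *\<^sub>R f1 q + a2 q *\<^sub>R f2 q) \<and>
      (\<forall>q. g1 q = b11 q *\<^sub>R f1 q + b21 q *\<^sub>R f2 q) \<and>
      (\<forall>q. g2 q = b12 q *\<^sub>R f1 q + b22 q *\<^sub>R f2 q))" (is "?L \<longleftrightarrow> ?R")
proof
  assume ?L
  then obtain B :: "'a \<Rightarrow> real^2^2" and a :: "'a \<Rightarrow> real^2"
    where B: "smooth_map A B" and a: "smooth_map A a" and inv: "\<And>q. invertible (B q)"
      and eq: "\<And>q v. f0 q + ((B q *v v + a q) $ 1) *\<^sub>R f1 q + ((B q *v v + a q) $ 2) *\<^sub>R f2 q =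
        g0 q + (v $ 1) *\<^sub>R g1 q + (v $ 2) *\<^sub>R g2 q"
    unfolding feedback_equivalent_def Let_def by blast
  have g0: "g0 q = f0 q + (a q $ 1) *\<^sub>R f1 q + (a q $ 2) *\<^sub>R f2 q" for q
    using eq[of q 0] by simp
  have g: "g1 q = (B q $ 1 $ 1) *\<^sub>R f1 q + (B q $ 2 $ 1) *\<^sub>R f2 q"
    "g2 q = (B q $ 1 $ 2) *\<^sub>R f1 q + (B q $ 2 $ 2) *\<^sub>R f2 q" for q
    using eq[of q "vector [1, 0]"] eq[of q "vector [0, 1]"]
    by (simp_all add: g0 matrix_vector_mult_def sum_2 algebra_simps)
  have s: "smooth_map A (\<lambda>q. a q $ i)" "smooth_map A (\<lambda>q. B q $ i $ j)" for i j
    using a B unfolding smooth_map_vec[of a] smooth_map_matrix by blast+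
  have det: "B q $ 1 $ 1 * B q $ 2 $ 2 - B q $ 1 $ 2 * B q $ 2 $ 1 \<noteq> 0" for q
    using inv[of q] unfolding invertible_det_nz det_2 .
  show ?R
    by (intro exI[of _ "\<lambda>q. a q $ 1"] exI[of _ "\<lambda>q. a q $ 2"] exI[of _ "\<lambda>q. B q $ 1 $ 1"]
        exI[of _ "\<lambda>q. B q $ 1 $ 2"] exI[of _ "\<lambda>q. B q $ 2 $ 1"] exI[of _ "\<lambda>q. B q $ 2 $ 2"]
        conjI allI s det g0 g)
next
  assume ?R
  then obtain a1 a2 b11 b12 b21 b22 where
    s: "smooth_map A a1" "smooth_map A a2" "smooth_map A b11" "smooth_map A b12"
      "smooth_map A b21" "smooth_map A b22" and det: "\<And>q. b11 q * b22 q - b12 q * b21 q \<noteq> 0"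
    and g: "\<And>q. g0 q = f0 q + a1 q *\<^sub>R f1 q + a2 q *\<^sub>R f2 q"
      "\<And>q. g1 q = b11 q *\<^sub>R f1 q + b21 q *\<^sub>R f2 q"
      "\<And>q. g2 q = b12 q *\<^sub>R f1 q + b22 q *\<^sub>R f2 q" by blast
  define a :: "'a \<Rightarrow> real^2" where "a q = vector [a1 q, a2 q]" for q
  define B :: "'a \<Rightarrow> real^2^2" where
    "B q = vector [vector [b11 q, b12 q], vector [b21 q, b22 q]]" for q
  have "smooth_map A a" "smooth_map A B"
    using s unfolding smooth_map_vec[of a] smooth_map_matrix by (simp_all add: forall_2 a_def B_def)
  moreover have "invertible (B q)" for q
    using det[of q] by (simp add: invertible_det_nz det_2 B_def)
  moreover have "f0 q + ((B q *v v + a q) $ 1) *\<^sub>R f1 q + ((B q *v v + a q) $ 2) *\<^sub>R f2 q =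
        g0 q + (v $ 1) *\<^sub>R g1 q + (v $ 2) *\<^sub>R g2 q" for q v
    by (simp add: g a_def B_def matrix_vector_mult_def sum_2 algebra_simps)
  ultimately show ?L
    unfolding feedback_equivalent_def Let_def by blast
qed

end

section \<open>Reduction and normal form\<close>

locale scalar_system = manifold A
  for A :: "('a::{t2_space,second_countable_topology}, 'e::euclidean_space) chart set" +
  fixes g0 g1 :: "'a \<Rightarrow> 'e"
  assumes g: "vector_field A g0" "vector_field A g1"
    and dimension: "DIM('e) = 5"
    and generic: "\<And>q. dim (span {g0 q, g1 q, lie_bracket A g1 g0 q,
                   lie_bracket A g1 (lie_bracket A g1 g0) q,
                   lie_bracket A g0 (lie_bracket A g1 g0) q}) = 5"
begin

definition K where "K = lie_bracket A g1 g0"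
definition Z1 where "Z1 = lie_bracket A g1 K"
definition Z0 where "Z0 = lie_bracket A g0 K"

lemma K: "vector_field A K"
  unfolding K_def by (rule vector_field_lie_bracket[OF g(2,1)])

lemma generic_frame:
  "distinct [g0 q, g1 q, K q, Z1 q, Z0 q]" "independent {g0 q, g1 q, K q, Z1 q, Z0 q}"
  using full_dim_span_list[of "[g0 q, g1 q, K q, Z1 q, Z0 q]"] generic[of q]
  by (simp_all add: K_def Z1_def Z0_def)

text \<open>The minus sign comes from the order of the bracket: \<open>K\<close> is
  \<open>[g1, g0]\<close>, as in the hypothesis on the five fields, while the normal form contains
  \<open>[g0, g1]\<close>.\<close>

definition third :: "('a \<Rightarrow> real) \<Rightarrow> 'a \<Rightarrow> 'e" where
  "third \<alpha> q = \<alpha> q *\<^sub>R g0 q - K q"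

lemma third_eq: "(\<lambda>q. \<alpha> q *\<^sub>R g0 q + lie_bracket A g0 g1 q) = third \<alpha>"
  by (simp add: third_def[abs_def] K_def lie_bracket_commute[of g0 g1])

lemma frame_third:
  assumes "smooth_map A \<alpha>"
  shows "frame g0 g1 (third \<alpha>)"
proof -
  have "indep_family (tri (g0 q) (g1 q) (third \<alpha> q))" for q
    unfolding indep_family_tri
  proof (intro allI impI)
    fix a b c assume "a *\<^sub>R g0 q + b *\<^sub>R g1 q + c *\<^sub>R third \<alpha> q = 0"
    then have "(a + c * \<alpha> q) *\<^sub>R g0 q + b *\<^sub>R g1 q + (- c) *\<^sub>R K q = 0"
      by (simp add: third_def algebra_simps)
    then have "a + c * \<alpha> q = 0 \<and> b = 0 \<and> - c = 0"
      using indep_family_tri_of_independent[OF generic_frame] unfolding indep_family_tri by blast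
    then show "a = 0 \<and> b = 0 \<and> c = 0" by auto
  qed
  then show ?thesis
    unfolding frame_def third_def[abs_def] using g K assms vector_field_scale_diff by blast
qed

text \<open>For a covector killing \<open>g0\<close> and \<open>K\<close> these brackets reduce to
  \<open>- Z1\<close> and \<open>- Z0\<close>, whatever \<alpha> is.\<close>

lemma brackets_third:
  assumes "smooth_map A \<alpha>"
  shows "lie_bracket A g1 (third \<alpha>) q = \<alpha> q *\<^sub>R K q + lie_deriv g1 \<alpha> q *\<^sub>R g0 q - Z1 q"
    "lie_bracket A g0 (third \<alpha>) q = lie_deriv g0 \<alpha> q *\<^sub>R g0 q - Z0 q"
  using lie_bracket_scale_diff_right[OF g(1) g(1) K assms, of q]
    lie_bracket_scale_diff_right[OF g(2) g(1) K assms, of q]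
  by (simp_all add: third_def[abs_def] lie_bracket_self Z1_def Z0_def K_def)

lemma Abn_third:
  assumes "smooth_map A \<alpha>"
  shows "Abn A g0 g1 (third \<alpha>) q = {g0 q + u *\<^sub>R g1 q |u. u \<in> (UNIV :: real set)}"
proof -
  let ?g2 = "third \<alpha>"
  note frame = frame_third[OF assms]
  have K0: "p \<bullet> K q = 0" if "p \<bullet> g0 q = 0" "p \<bullet> ?g2 q = 0" for p
    using that by (simp add: third_def inner_diff_right)
  \<comment> \<open>The coefficient of the third field has numerator
    \<open>p \<bullet> K q = 0\<close>, so only the \<open>g1\<close> direction survives.\<close>
  have vel: "abn_velocity g0 g1 ?g2 q p = g0 q + (- (p \<bullet> Z0 q) / (p \<bullet> Z1 q)) *\<^sub>R g1 q"
    if "abn_covector g0 g1 ?g2 q p" for p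
    using that K0[of p] brackets_third[OF assms]
    by (simp add: abn_velocity_def abn_covector_def lie_bracket_commute[of ?g2 g1]
        K_def[symmetric] inner_diff_right inner_add_right)
  have "\<exists>p. abn_covector g0 g1 ?g2 q p \<and> - (p \<bullet> Z0 q) / (p \<bullet> Z1 q) = u" for u
  proof -
    \<comment> \<open>Independence of the five vectors permits any prescribed values; -1 on
      \<open>Z1\<close> and \<open>u\<close> on \<open>Z0\<close> make the ratio equal to
      \<open>u\<close>.\<close>
    obtain l :: "'e \<Rightarrow> real" where l: "linear l"
      and l_eq: "\<And>x. x \<in> {g0 q, g1 q, K q, Z1 q, Z0 q} \<Longrightarrow>
        l x = (if x = Z1 q then - 1 else if x = Z0 q then u else 0)"
      using linear_independent_extend[OF generic_frame(2)[of q],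
          of "\<lambda>x. if x = Z1 q then - 1 else if x = Z0 q then u else 0"] by blast
    \<comment> \<open>The vector representing the functional \<open>l\<close> through the inner
      product.\<close>
    define p where "p = adjoint l 1"
    have "p \<bullet> x = l x" for x
      using adjoint_works[OF l, of x 1] by (simp add: p_def inner_commute)
    then have p: "p \<bullet> g0 q = 0" "p \<bullet> g1 q = 0" "p \<bullet> K q = 0" "p \<bullet> Z1 q = - 1" "p \<bullet> Z0 q = u"
      using l_eq generic_frame(1)[of q] by auto
    then have "abn_covector g0 g1 ?g2 q p"
      using brackets_third(1)[OF assms, of q]
      by (simp add: abn_covector_def third_def inner_diff_right inner_add_right)
    then show ?thesis using p by (intro exI[of _ p]) simp
  qed
  note solve = this
  show ?thesis
    unfolding Abn_eq[OF frame]
  proof (intro equalityI subsetI)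
    fix x assume "x \<in> {g0 q + u *\<^sub>R g1 q |u. u \<in> (UNIV :: real set)}"
    then obtain u where x: "x = g0 q + u *\<^sub>R g1 q" by blast
    obtain p where p: "abn_covector g0 g1 ?g2 q p" "- (p \<bullet> Z0 q) / (p \<bullet> Z1 q) = u"
      using solve by blast
    have "x = abn_velocity g0 g1 ?g2 q p"
      unfolding vel[OF p(1)] p(2) by (rule x)
    with p(1) show "x \<in> abn_velocity g0 g1 ?g2 q ` {p. abn_covector g0 g1 ?g2 q p}"
      by blast
  qed (use vel in blast)
qed

text \<open>Feedback preserves both distributions, so the two dimension conditions can be checked on
  the normal form, where the squares are expressed through the five independent fields.\<close>

lemma reduction_of_normal_form:
  assumes f: "frame f0 f1 f2" and \<alpha>: "smooth_map A \<alpha>"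
    and eq: "feedback_equivalent A f0 f1 f2 g0 g1 (third \<alpha>)"
  shows "has_reduction A f0 f1 f2 g0 g1"
proof -
  let ?g2 = "third \<alpha>"
  note frame = frame_third[OF \<alpha>]
  obtain a1 a2 b11 b12 b21 b22 where
    g0: "\<And>q. g0 q = f0 q + a1 q *\<^sub>R f1 q + a2 q *\<^sub>R f2 q" and
    g1: "\<And>q. g1 q = b11 q *\<^sub>R f1 q + b21 q *\<^sub>R f2 q" and
    g2: "\<And>q. ?g2 q = b12 q *\<^sub>R f1 q + b22 q *\<^sub>R f2 q"
    using eq unfolding feedback_equivalent_iff by blast
  have D2: "D2 f1 f2 = D2 g1 ?g2"
  proof
    fix q
    have "range (duo (g1 q) (?g2 q)) \<subseteq> span (range (duo (f1 q) (f2 q)))"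
      unfolding range_duo g1 g2 by (auto intro!: span_add span_scale intro: span_base)
    from indep_family_span_eq[OF frameD(7)[OF f] frameD(7)[OF frame] this]
    show "D2 f1 f2 q = D2 g1 ?g2 q"
      by (simp add: D2_def range_duo)
  qed
  have D3: "D3 f0 f1 f2 = D3 g0 g1 ?g2"
  proof
    fix q
    have "range (tri (g0 q) (g1 q) (?g2 q)) \<subseteq> span (range (tri (f0 q) (f1 q) (f2 q)))"
      unfolding range_tri g0 g1 g2 by (auto intro!: span_add span_scale intro: span_base)
    from indep_family_span_eq[OF frameD(5)[OF f] frameD(5)[OF frame] this]
    show "D3 f0 f1 f2 q = D3 g0 g1 ?g2 q"
      by (simp add: D3_def range_tri)
  qed
  have "dim (set_plus_pt (dist_square A (D2 f1 f2)) (D3 f0 f1 f2) q) = 4" for q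
  proof -
    \<comment> \<open>Modulo D3, the bracket of the two input fields contributes
      \<open>- Z1\<close>, and D3 itself is spanned by \<open>g0\<close>, \<open>g1\<close>,
      \<open>K\<close>: four of the five fields.\<close>
    let ?S = "{g0 q, g1 q, K q, Z1 q}"
    let ?T = "{g1 q, ?g2 q, lie_bracket A g1 ?g2 q} \<union> {g0 q, g1 q, ?g2 q}"
    have "set_plus_pt (dist_square A (D2 f1 f2)) (D3 f0 f1 f2) q = span ?T"
      unfolding D2 D3 set_plus_pt_def dist_square_D2[OF frame] D3_def span_Un by blast
    also have "\<dots> = span ?S"
    proof (intro span_eq[THEN iffD2] conjI)
      have S: "g0 q \<in> span ?S" "g1 q \<in> span ?S" "K q \<in> span ?S" "Z1 q \<in> span ?S"
        by (simp_all add: span_base)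
      then have "?g2 q \<in> span ?S" "lie_bracket A g1 ?g2 q \<in> span ?S"
        unfolding brackets_third[OF \<alpha>] unfolding third_def
        by (simp_all add: span_diff span_add span_scale)
      with S show "?T \<subseteq> span ?S" by blast
      have T: "g0 q \<in> span ?T" "g1 q \<in> span ?T" "?g2 q \<in> span ?T" "lie_bracket A g1 ?g2 q \<in> span ?T"
        by (simp_all add: span_base)
      have "K q = \<alpha> q *\<^sub>R g0 q - ?g2 q" by (simp add: third_def)
      moreover have "\<alpha> q *\<^sub>R g0 q - ?g2 q \<in> span ?T"
        using T by (intro span_diff span_scale)
      ultimately have K: "K q \<in> span ?T" by metis
      have "Z1 q = \<alpha> q *\<^sub>R K q + lie_deriv g1 \<alpha> q *\<^sub>R g0 q - lie_bracket A g1 ?g2 q"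
        by (simp add: brackets_third[OF \<alpha>])
      moreover have "\<alpha> q *\<^sub>R K q + lie_deriv g1 \<alpha> q *\<^sub>R g0 q - lie_bracket A g1 ?g2 q \<in> span ?T"
        using T K by (intro span_diff span_add span_scale)
      ultimately have "Z1 q \<in> span ?T" by metis
      with T K show "?S \<subseteq> span ?T" by blast
    qed
    also have "dim \<dots> = card ?S"
      unfolding dim_span
      by (rule dim_eq_card_independent[OF independent_mono[OF generic_frame(2)[of q]]]) auto
    finally show ?thesis using generic_frame(1)[of q] by simp
  qed
  moreover have "dim (dist_square A (D3 f0 f1 f2) q) = 5" for q
  proof -
    let ?Q = "dist_square A (D3 f0 f1 f2) q"
    have sub: "subspace ?Q"
      unfolding D3_eq dist_square_frame[OF frameD(4)[OF f] frameD(8)[OF f]] by (rule subspace_span)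
    have T: "g0 q \<in> ?Q" "g1 q \<in> ?Q" "?g2 q \<in> ?Q" "lie_bracket A g1 ?g2 q \<in> ?Q"
        "lie_bracket A g0 ?g2 q \<in> ?Q"
      using dist_square_D3_supset[OF frame, of q] unfolding D3 by auto
    \<comment> \<open>Solving the formulas for \<open>third \<alpha>\<close> and its brackets
      backwards puts all five fields into the square.\<close>
    have "\<alpha> q *\<^sub>R g0 q - ?g2 q \<in> ?Q"
      using T by (intro subspace_diff subspace_scale sub)
    then have K: "K q \<in> ?Q" by (simp add: third_def)
    have "\<alpha> q *\<^sub>R K q + lie_deriv g1 \<alpha> q *\<^sub>R g0 q - lie_bracket A g1 ?g2 q \<in> ?Q"
      "lie_deriv g0 \<alpha> q *\<^sub>R g0 q - lie_bracket A g0 ?g2 q \<in> ?Q"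
      using T K by (simp_all add: subspace_diff subspace_add subspace_scale sub)
    then have "Z1 q \<in> ?Q" "Z0 q \<in> ?Q" by (simp_all add: brackets_third[OF \<alpha>])
    with T K have "dim {g0 q, g1 q, K q, Z1 q, Z0 q} \<le> dim ?Q"
      by (intro dim_subset) auto
    moreover have "dim {g0 q, g1 q, K q, Z1 q, Z0 q} = 5"
      using generic[of q] by (simp add: K_def Z1_def Z0_def)
    moreover have "dim ?Q \<le> 5"
      using dim_subset_UNIV[of ?Q] dimension by simp
    ultimately show ?thesis by simp
  qed
  moreover have "Abn A f0 f1 f2 q = {g0 q + u *\<^sub>R g1 q |u. u \<in> (UNIV :: real set)}" for q
    unfolding Abn_feedback[OF f frame g0 g1 g2 D3[symmetric, THEN fun_cong]] by (rule Abn_third[OF \<alpha>])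
  ultimately show ?thesis
    unfolding has_reduction_def by blast
qed

lemma normal_form_of_reduction:
  assumes f: "frame f0 f1 f2" and red: "has_reduction A f0 f1 f2 g0 g1"
  shows "\<exists>\<alpha>. smooth_map A \<alpha> \<and> feedback_equivalent A f0 f1 f2 g0 g1 (third \<alpha>)"
proof -
  have Abn: "\<exists>p. abn_covector f0 f1 f2 q p \<and> g0 q + u *\<^sub>R g1 q = abn_velocity f0 f1 f2 q p" for q u
    using red unfolding has_reduction_def Abn_eq[OF f] by blast
  \<comment> \<open>The quotients are cleared: \<open>c1\<close> and \<open>c2\<close> are the
    coefficients of the velocity, and the last two equations say that it lies in the kernel of the
    form of \<open>p\<close>.\<close>
  have vel: "\<exists>c1 c2. g0 q + u *\<^sub>R g1 q = f0 q + c1 *\<^sub>R f1 q + c2 *\<^sub>R f2 q \<and> (\<exists>p.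
      p \<bullet> f0 q = 0 \<and> p \<bullet> f1 q = 0 \<and> p \<bullet> f2 q = 0 \<and> p \<bullet> lie_bracket A f1 f2 q \<noteq> 0 \<and>
      p \<bullet> lie_bracket A f0 f1 q = c2 * (p \<bullet> lie_bracket A f1 f2 q) \<and>
      p \<bullet> lie_bracket A f0 f2 q = - c1 * (p \<bullet> lie_bracket A f1 f2 q))" for q u
  proof -
    obtain p where p: "abn_covector f0 f1 f2 q p" "g0 q + u *\<^sub>R g1 q = abn_velocity f0 f1 f2 q p"
      using Abn by blast
    show ?thesis
      by (rule exI[of _ "p \<bullet> lie_bracket A f0 f2 q / (p \<bullet> lie_bracket A f2 f1 q)"],
          rule exI[of _ "p \<bullet> lie_bracket A f1 f0 q / (p \<bullet> lie_bracket A f2 f1 q)"])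
        (use p in \<open>auto simp: abn_covector_def abn_velocity_def lie_bracket_commute[of f1 f0]
          lie_bracket_commute[of f2 f1] intro!: exI[of _ p]\<close>)
  qed
  obtain a1 a2 p0 where g0: "\<And>q. g0 q = f0 q + a1 q *\<^sub>R f1 q + a2 q *\<^sub>R f2 q"
    and p0: "\<And>q. p0 q \<bullet> f0 q = 0" "\<And>q. p0 q \<bullet> f1 q = 0" "\<And>q. p0 q \<bullet> f2 q = 0"
      "\<And>q. p0 q \<bullet> lie_bracket A f1 f2 q \<noteq> 0"
      "\<And>q. p0 q \<bullet> lie_bracket A f0 f1 q = a2 q * (p0 q \<bullet> lie_bracket A f1 f2 q)"
      "\<And>q. p0 q \<bullet> lie_bracket A f0 f2 q = - a1 q * (p0 q \<bullet> lie_bracket A f1 f2 q)"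
    using vel[of _ 0] by simp metis
  obtain c1 c2 p1 where c: "\<And>q. g0 q + g1 q = f0 q + c1 q *\<^sub>R f1 q + c2 q *\<^sub>R f2 q"
    and p1: "\<And>q. p1 q \<bullet> f0 q = 0" "\<And>q. p1 q \<bullet> f1 q = 0" "\<And>q. p1 q \<bullet> f2 q = 0"
      "\<And>q. p1 q \<bullet> lie_bracket A f1 f2 q \<noteq> 0"
      "\<And>q. p1 q \<bullet> lie_bracket A f0 f1 q = c2 q * (p1 q \<bullet> lie_bracket A f1 f2 q)"
      "\<And>q. p1 q \<bullet> lie_bracket A f0 f2 q = - c1 q * (p1 q \<bullet> lie_bracket A f1 f2 q)"
    using vel[of _ 1] by simp metis
  define b1 where "b1 q = c1 q - a1 q" for q
  define b2 where "b2 q = c2 q - a2 q" for q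
  have g1: "g1 q = b1 q *\<^sub>R f1 q + b2 q *\<^sub>R f2 q" for q
    using g0[of q] c[of q] by (simp add: b1_def b2_def algebra_simps)
  have g0': "g0 q = 1 *\<^sub>R f0 q + a1 q *\<^sub>R f1 q + a2 q *\<^sub>R f2 q" for q
    by (simp add: g0)
  have g1': "g1 q = 0 *\<^sub>R f0 q + b1 q *\<^sub>R f1 q + b2 q *\<^sub>R f2 q" for q
    by (simp add: g1)
  have "K q \<in> span (range (tri (f0 q) (f1 q) (f2 q)))" for q
  proof -
    \<comment> \<open>\<open>g0\<close> is in the kernel of the form of \<open>p0\<close>, and
      \<open>g0 + g1\<close> in that of \<open>p1\<close>; replacing \<open>g0\<close> by
      \<open>g0 + g1\<close> does not change the form on the pair with \<open>g1\<close>.\<close>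
    have "p0 q \<bullet> lie_bracket A g0 g1 q = 0" "p1 q \<bullet> lie_bracket A g0 g1 q = 0"
      unfolding inner_lie_bracket_triple[OF f g(1) g0' g(2) g1' p0(1-3)]
        inner_lie_bracket_triple[OF f g(1) g0' g(2) g1' p1(1-3)] p0(5,6) p1(5,6)
      by (simp_all add: b1_def b2_def algebra_simps)
    then have pK: "p0 q \<bullet> K q = 0" "p1 q \<bullet> K q = 0"
      by (simp_all add: K_def lie_bracket_commute[of g1 g0])
    have "indep_family (duo (p0 q) (p1 q))"
      unfolding indep_family_duo
    proof (intro allI impI)
      fix c d assume "c *\<^sub>R p0 q + d *\<^sub>R p1 q = 0"
      then have cd: "c * (p0 q \<bullet> x) + d * (p1 q \<bullet> x) = 0" for x
        by (metis inner_add_left inner_scaleR_left inner_zero_left)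
      \<comment> \<open>A linear relation is tested on the three brackets of the old fields.
        Eliminating \<open>c\<close> leaves \<open>d\<close> times the components \<open>b1\<close>,
        \<open>b2\<close> of \<open>g1\<close>, which do not both vanish.\<close>
      have 1: "c * (p0 q \<bullet> lie_bracket A f1 f2 q) = - (d * (p1 q \<bullet> lie_bracket A f1 f2 q))"
        using cd[of "lie_bracket A f1 f2 q"] by simp
      have "d * (p1 q \<bullet> lie_bracket A f1 f2 q) * b2 q = 0"
        using cd[of "lie_bracket A f0 f1 q"] 1 unfolding p0(5) p1(5) b2_def by algebra
      moreover have "d * (p1 q \<bullet> lie_bracket A f1 f2 q) * b1 q = 0"
        using cd[of "lie_bracket A f0 f2 q"] 1 unfolding p0(6) p1(6) b1_def by algebra
      moreover have "b1 q \<noteq> 0 \<or> b2 q \<noteq> 0"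
      proof (rule ccontr)
        assume "\<not> (b1 q \<noteq> 0 \<or> b2 q \<noteq> 0)"
        then have "g1 q = 0" by (simp add: g1)
        then show False using generic_frame(2)[of q] dependent_zero[of "{g0 q, g1 q, K q, Z1 q, Z0 q}"]
          by simp
      qed
      ultimately have "d = 0" using p1(4)[of q] by auto
      with 1 p0(4)[of q] show "c = 0 \<and> d = 0" by simp
    qed
    then have dim2: "dim (span {p0 q, p1 q}) = 2"
      using dim_indep_family[of "duo (p0 q) (p1 q)"] by (simp add: range_duo)
    \<comment> \<open>\<open>N\<close> is the common kernel of the two covectors; it has dimension 5
      - 2 = 3 and contains the three-dimensional D3, hence equals it.\<close>
    define N where "N = {y \<in> UNIV. \<forall>x\<in>span {p0 q, p1 q}. orthogonal x y}"
    have "dim N + dim (span {p0 q, p1 q}) = dim (UNIV :: 'e set)"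
      unfolding N_def by (rule dim_subspace_orthogonal_to_vectors) (auto intro: subspace_span)
    then have dimN: "dim N = 3" using dim2 dimension by simp
    have N: "y \<in> N \<longleftrightarrow> p0 q \<bullet> y = 0 \<and> p1 q \<bullet> y = 0" for y
      using annihilates_span[of "{p0 q, p1 q}" y]
      by (simp add: N_def orthogonal_def inner_commute)
    have "span (range (tri (f0 q) (f1 q) (f2 q))) = N"
    proof (rule subspace_dim_equal)
      show N_sub: "subspace N"
        by (auto simp: subspace_def N inner_add_right)
      show "span (range (tri (f0 q) (f1 q) (f2 q))) \<subseteq> N"
        by (rule span_minimal[OF _ N_sub]) (simp add: range_tri N p0 p1)
      show "dim N \<le> dim (span (range (tri (f0 q) (f1 q) (f2 q))))"
        unfolding dimN dim_indep_family[OF frameD(5)[OF f]] by simp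
    qed simp
    then show ?thesis using pK by (simp add: N)
  qed
  then have "\<exists>c. K q = (\<Sum>i\<in>UNIV. c i *\<^sub>R tri (f0 q) (f1 q) (f2 q) i)" for q
    by (metis span_range_coefficients)
  then obtain k where "\<And>q. K q = (\<Sum>i\<in>UNIV. k q i *\<^sub>R tri (f0 q) (f1 q) (f2 q) i)"
    by metis
  then have Kk: "K q = k q 1 *\<^sub>R f0 q + k q 2 *\<^sub>R f1 q + k q 3 *\<^sub>R f2 q" for q
    by (simp add: sum_3)
  \<comment> \<open>Since \<open>g0\<close> and \<open>f0\<close> differ by an element of D2, taking
    the \<open>f0\<close>-component of \<open>K\<close> is what places
    \<open>\<alpha> g0 - K\<close> in D2.\<close>
  define \<alpha> where "\<alpha> q = k q 1" for q
  have \<alpha>: "smooth_map A \<alpha>"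
    unfolding \<alpha>_def by (rule smooth_map_triple_coefficients(1)[OF f K Kk])
  note frame = frame_third[OF \<alpha>]
  define d1 where "d1 q = \<alpha> q * a1 q - k q 2" for q
  define d2 where "d2 q = \<alpha> q * a2 q - k q 3" for q
  have g2: "third \<alpha> q = d1 q *\<^sub>R f1 q + d2 q *\<^sub>R f2 q" for q
    by (simp add: third_def Kk g0 d1_def d2_def \<alpha>_def algebra_simps)
  then have g2': "third \<alpha> q = 0 *\<^sub>R f0 q + d1 q *\<^sub>R f1 q + d2 q *\<^sub>R f2 q" for q
    by simp
  \<comment> \<open>Invertibility needs no computation: \<open>g1\<close> and
    \<open>third \<alpha>\<close> are already independent by the hypothesis on the five
    fields.\<close>
  have "b1 q * d2 q - d1 q * b2 q \<noteq> 0" for q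
    by (rule feedback_det[OF frameD(7)[OF frame] g1 g2])
  then have "feedback_equivalent A f0 f1 f2 g0 g1 (third \<alpha>)"
    unfolding feedback_equivalent_iff
    using smooth_map_triple_coefficients[OF f g(1) g0'] smooth_map_triple_coefficients[OF f g(2) g1']
      smooth_map_triple_coefficients[OF f frameD(3)[OF frame] g2'] g0 g1 g2
    by (intro exI[of _ a1] exI[of _ a2] exI[of _ b1] exI[of _ d1] exI[of _ b2] exI[of _ d2]) simp
  with \<alpha> show ?thesis by blast
qed

end

theorem corollary3:
  fixes A :: "('a::{t2_space,second_countable_topology}, real^5) chart set"
    and g0 g1 f0 f1 f2 :: "'a \<Rightarrow> real^5"
  assumes "smooth_atlas A"
    and "vector_field A g0" and "vector_field A g1"
    and "\<And>q. dim (span {g0 q, g1 q, lie_bracket A g1 g0 q,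
                   lie_bracket A g1 (lie_bracket A g1 g0) q,
                   lie_bracket A g0 (lie_bracket A g1 g0) q}) = 5"
    and "control_system2 A f0 f1 f2"
  shows "has_reduction A f0 f1 f2 g0 g1 \<longleftrightarrow>
     (\<exists>\<alpha> :: 'a \<Rightarrow> real. smooth_map A \<alpha> \<and>
        feedback_equivalent A f0 f1 f2
          g0 g1 (\<lambda>q. \<alpha> q *\<^sub>R g0 q + lie_bracket A g0 g1 q))"
proof -
  interpret scalar_system A g0 g1
    by unfold_locales (use assms in simp_all)
  have f: "frame f0 f1 f2"
    by (rule frame_control_system2[OF assms(5)])
  show ?thesis
    unfolding third_eq using reduction_of_normal_form[OF f] normal_form_of_reduction[OF f] by blast
qed

end
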